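(* Let $N\ge 1$ and, for $i=1,\dots,N$, let $H_i$ be a Hamiltonian on $\mathbb{C}^{d_i}$ that is diagonal with real entries in a fixed orthonormal basis of $\mathbb{C}^{d_i}$. Let $H_{tot}=H_1+\dots+H_N$ be the non-interacting Hamiltonian on $\mathbb{C}^{d_1}\otimes\dots\otimes\mathbb{C}^{d_N}$ (each $H_i$ acting on the $i$-th factor and as the identity on the others). Let $0<T<T'<\infty$, let $\rho_T^i,\rho_{T'}^i$ be the thermal states of $H_i$ at temperatures $T,T'$, let $\rho_T=\bigotimes_i\rho_T^i$ and $\rho_{T'}=\bigotimes_i\rho^i_{T'}$, and put $$\Delta E=\mathrm{Tr}[H_{tot}(\rho_{T'}-\rho_T)],\qquad M=\sum_{i=1}^N\left[S(\rho^i_{T'})-S(\rho^i_T)\right].$$ Let $U$ be a unitary on $\mathbb{C}^{d_1}\otimes\dots\otimes\mathbb{C}^{d_N}$ with energy cost $\mathrm{Tr}[H_{tot}(U\rho_TU^\dagger-\rho_T)]=\Delta E$, and let $\rho_f=U\rho_TU^\dagger$. (a) If $U$ creates maximal total correlation at energy cost $\Delta E$, i.e. $I(\rho_f)=I^{\Delta E}_{max}=M$, then the coherence created satisfies $C_r(\rho_f)\le I^{\Delta E}_{max}$. (b) If $U$ creates maximal coherence at energy cost $\Delta E$, i.e. $C_r(\rho_f)=C^{\Delta E}_{r,max}=M$, then the total correlation created satisfies $I(\rho_f)\le C^{\Delta E}_{r,max}$.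
   Context: The thermal state of a Hamiltonian $H$ at temperature $T=1/\beta$ (Boltzmann constant 1) is $e^{-\beta H}/\mathrm{Tr}[e^{-\beta H}]$. Logarithms are to base 2. $S(\rho)=-\mathrm{Tr}(\rho\log\rho)$ is the von Neumann entropy. The relative entropy of coherence is $C_r(\rho)=S(\rho^D)-S(\rho)$, where $\rho^D$ is the diagonal part of $\rho$ in the reference basis, here the product of the fixed local energy eigenbases. The total correlation (multipartite mutual information) of a state $\rho$ with one-party marginals $\rho^1,\dots,\rho^N$ is $I(\rho)=\sum_{i=1}^NS(\rho^i)-S(\rho)$. The symbols $I^{\Delta E}_{max}$ and $C^{\Delta E}_{r,max}$ denote the maximal correlation and the maximal coherence creatable from $\rho_T$ by unitaries at energy cost $\Delta E$; both are taken to be equal to $M$. *)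

theory Defs
  imports Complex_Main "Jordan_Normal_Form.Schur_Decomposition"
begin

definition mat_trace :: "complex mat \<Rightarrow> complex" where
  "mat_trace A = (\<Sum>k<dim_row A. A $$ (k, k))"

definition unitary_mat :: "nat \<Rightarrow> complex mat \<Rightarrow> bool" where
  "unitary_mat n U \<longleftrightarrow> U \<in> carrier_mat n n \<and>
     mat_adjoint U * U = 1\<^sub>m n \<and> U * mat_adjoint U = 1\<^sub>m n"

text \<open>Functional calculus: if \<open>A = V diag(x) V\<^sup>\<dagger>\<close> with \<open>V\<close> unitary and \<open>x\<close> real, then
  \<open>f(A) = V diag(f(x)) V\<^sup>\<dagger>\<close>, which does not depend on the choice of the diagonalization.
  It is meaningful for Hermitian \<open>A\<close> only.\<close>

definition herm_fun :: "(real \<Rightarrow> real) \<Rightarrow> complex mat \<Rightarrow> complex mat" where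
  "herm_fun f A = (THE F. \<exists>V x. unitary_mat (dim_row A) V \<and>
     A = V * mat_diag (dim_row A) (\<lambda>k. complex_of_real (x k)) * mat_adjoint V \<and>
     F = V * mat_diag (dim_row A) (\<lambda>k. complex_of_real (f (x k))) * mat_adjoint V)"

text \<open>The value of the logarithm at 0 is irrelevant below, since it is multiplied by the
  eigenvalue 0 (so \<open>0 log 0 = 0\<close>). Traces of products of Hermitian matrices are real.\<close>

definition vn_entropy :: "complex mat \<Rightarrow> real" where
  "vn_entropy \<rho> = - Re (mat_trace (\<rho> * herm_fun (log 2) \<rho>))"

definition thermal :: "real \<Rightarrow> complex mat \<Rightarrow> complex mat" where
  "thermal T H = (let \<beta> = 1 / T; E = herm_fun (\<lambda>x. exp (- \<beta> * x)) H
     in (1 / mat_trace E) \<cdot>\<^sub>m E)"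

text \<open>An orthonormal basis of \<open>\<complex>\<^sup>n\<close> is given by the columns of a unitary matrix \<open>V\<close>.\<close>

definition real_diagonal_in :: "nat \<Rightarrow> complex mat \<Rightarrow> complex mat \<Rightarrow> bool" where
  "real_diagonal_in n V H \<longleftrightarrow> H \<in> carrier_mat n n \<and>
     diagonal_mat (mat_adjoint V * H * V) \<and>
     (\<forall>k<n. (mat_adjoint V * H * V) $$ (k, k) \<in> \<real>)"

definition diag_part :: "complex mat \<Rightarrow> complex mat \<Rightarrow> complex mat" where
  "diag_part V \<rho> =
     V * mat_diag (dim_row \<rho>) (\<lambda>k. (mat_adjoint V * \<rho> * V) $$ (k, k)) * mat_adjoint V"

definition rel_ent_coherence :: "complex mat \<Rightarrow> complex mat \<Rightarrow> real" where
  "rel_ent_coherence V \<rho> = vn_entropy (diag_part V \<rho>) - vn_entropy \<rho>"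

text \<open>The space \<open>\<complex>\<^bsup>d 0\<^esup> \<otimes> \<dots> \<otimes> \<complex>\<^bsup>d (N - 1)\<^esup>\<close> is identified with \<open>\<complex>\<^sup>D\<close>,
  \<open>D = d 0 * \<dots> * d (N - 1)\<close>, by numbering the product basis in mixed radix: the \<open>k\<close>-th basis
  vector is \<open>e\<^bsub>digit d 0 k\<^esub> \<otimes> \<dots> \<otimes> e\<^bsub>digit d (N - 1) k\<^esub>\<close>.\<close>

definition tot_dim :: "(nat \<Rightarrow> nat) \<Rightarrow> nat \<Rightarrow> nat" where
  "tot_dim d N = (\<Prod>i<N. d i)"

definition digit :: "(nat \<Rightarrow> nat) \<Rightarrow> nat \<Rightarrow> nat \<Rightarrow> nat" where
  "digit d i k = (k div (\<Prod>j<i. d j)) mod d i"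

definition tensor :: "(nat \<Rightarrow> nat) \<Rightarrow> nat \<Rightarrow> (nat \<Rightarrow> complex mat) \<Rightarrow> complex mat" where
  "tensor d N A = mat (tot_dim d N) (tot_dim d N)
     (\<lambda>(k, l). \<Prod>i<N. A i $$ (digit d i k, digit d i l))"

definition local_op :: "(nat \<Rightarrow> nat) \<Rightarrow> nat \<Rightarrow> nat \<Rightarrow> complex mat \<Rightarrow> complex mat" where
  "local_op d N i A = tensor d N (\<lambda>j. if j = i then A else 1\<^sub>m (d j))"

definition total_ham :: "(nat \<Rightarrow> nat) \<Rightarrow> nat \<Rightarrow> (nat \<Rightarrow> complex mat) \<Rightarrow> complex mat" where
  "total_ham d N H = mat (tot_dim d N) (tot_dim d N)
     (\<lambda>(k, l). \<Sum>i<N. local_op d N i (H i) $$ (k, l))"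

text \<open>Partial trace over all factors except the \<open>i\<close>-th.\<close>

definition marginal :: "(nat \<Rightarrow> nat) \<Rightarrow> nat \<Rightarrow> nat \<Rightarrow> complex mat \<Rightarrow> complex mat" where
  "marginal d N i \<rho> = mat (d i) (d i) (\<lambda>(a, b).
     \<Sum>(k, l) \<in> {(k, l). k < tot_dim d N \<and> l < tot_dim d N \<and>
                    digit d i k = a \<and> digit d i l = b \<and>
                    (\<forall>j<N. j \<noteq> i \<longrightarrow> digit d j k = digit d j l)}. \<rho> $$ (k, l))"

definition total_corr :: "(nat \<Rightarrow> nat) \<Rightarrow> nat \<Rightarrow> complex mat \<Rightarrow> real" where
  "total_corr d N \<rho> = (\<Sum>i<N. vn_entropy (marginal d N i \<rho>)) - vn_entropy \<rho>"

definition evolve :: "complex mat \<Rightarrow> complex mat \<Rightarrow> complex mat" where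
  "evolve U \<rho> = U * \<rho> * mat_adjoint U"

definition energy_diff :: "complex mat \<Rightarrow> complex mat \<Rightarrow> complex mat \<Rightarrow> real" where
  "energy_diff H \<sigma> \<rho> = Re (mat_trace (H * (\<sigma> - \<rho>)))"

text \<open>The states reachable from \<open>\<rho>\<close> by unitaries at energy cost exactly \<open>\<Delta>E\<close>.\<close>

definition reachable :: "complex mat \<Rightarrow> complex mat \<Rightarrow> real \<Rightarrow> complex mat set" where
  "reachable H \<rho> \<Delta>E =
     {evolve U \<rho> | U. unitary_mat (dim_row \<rho>) U \<and> energy_diff H (evolve U \<rho>) \<rho> = \<Delta>E}"

definition max_total_corr ::
  "(nat \<Rightarrow> nat) \<Rightarrow> nat \<Rightarrow> complex mat \<Rightarrow> complex mat \<Rightarrow> real \<Rightarrow> real" where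
  "max_total_corr d N H \<rho> \<Delta>E = Sup (total_corr d N ` reachable H \<rho> \<Delta>E)"

definition max_coherence ::
  "complex mat \<Rightarrow> complex mat \<Rightarrow> complex mat \<Rightarrow> real \<Rightarrow> real" where
  "max_coherence V H \<rho> \<Delta>E = Sup (rel_ent_coherence V ` reachable H \<rho> \<Delta>E)"

end

(* Both bounds rest on one inequality: a state at the energy of rho_{T'} satisfies
   S <= E / (T' ln 2) + log Z(T'), with equality for rho_{T'} itself (Gibbs variational principle,
   obtained from Klein's inequality). Since S(rho_f) = S(rho_T), it remains to apply it
   (a) to the diagonal part of rho_f, which has the energy of rho_f, and
   (b) to each one-party marginal of rho_f; the local energies of the marginals add up to the total
   energy of rho_f, and log Z is additive over the parties. *)

theory Submission
  imports Defs
begin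

section \<open>Matrices diagonalized by a unitary\<close>

text \<open>Entropy and thermal state are defined through \<open>herm_fun\<close>, a definite
  description, so nothing can be evaluated before its value is known not to depend on the
  diagonalization. After that, every matrix is brought to the form \<open>spectral n V x\<close>,
  and traces and entropies become sums over the real vector \<open>x\<close>. Hamiltonians, thermal
  states, \<open>\<rho>f\<close> and its diagonal part come with such a form. The marginals of
  \<open>\<rho>f\<close> do not: for them the Hermitian spectral theorem is proved, and their
  eigenvalues are recognized as sums of populations of \<open>\<rho>f\<close> in a suitable product
  basis, which makes them probabilities. The comparison state is the Gibbs state at T' because minus
  the logarithm of its weights is affine in the energy. A cross entropy against it therefore sees
  only the energy of a state, which the cost prescribes. The slope 1/(T' ln 2) carries ln 2 because
  the weights are natural exponentials and the logarithms are to base 2. Subtracting the entropy of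
  \<open>\<rho>f\<close> from the common bound gives exactly \<open>M\<close> in both cases.\<close>

lemma index_mult_mat_sum:
  assumes "A \<in> carrier_mat n m" "B \<in> carrier_mat m p" "i < n" "j < p"
  shows "(A * B) $$ (i, j) = (\<Sum>k<m. A $$ (i, k) * B $$ (k, j))"
  using assms by (auto simp: scalar_prod_def lessThan_atLeast0)

lemma mat_adjoint_carrier [simp]: "A \<in> carrier_mat n m \<Longrightarrow> mat_adjoint A \<in> carrier_mat m n"
  by (auto simp: mat_adjoint_def)

lemma dim_mat_adjoint [simp]:
  "dim_row (mat_adjoint A) = dim_col A" "dim_col (mat_adjoint A) = dim_row A"
  by (auto simp: mat_adjoint_def)

lemma index_mat_adjoint [simp]:
  fixes A :: "complex mat"
  shows "i < dim_col A \<Longrightarrow> j < dim_row A \<Longrightarrow> mat_adjoint A $$ (i, j) = cnj (A $$ (j, i))"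
  by (simp add: mat_adjoint_def mat_of_rows_def conjugate_complex_def)

lemma mat_adjoint_adjoint [simp]: "mat_adjoint (mat_adjoint A) = (A :: complex mat)"
  by (rule eq_matI) auto

lemma mat_adjoint_mult:
  fixes A :: "complex mat"
  assumes "A \<in> carrier_mat n m" "B \<in> carrier_mat m p"
  shows "mat_adjoint (A * B) = mat_adjoint B * mat_adjoint A"
proof (rule eq_matI)
  fix i j assume "i < dim_row (mat_adjoint B * mat_adjoint A)"
    "j < dim_col (mat_adjoint B * mat_adjoint A)"
  with assms have ij: "i < p" "j < n" by auto
  have "mat_adjoint (A * B) $$ (i, j) = cnj ((A * B) $$ (j, i))"
    using assms ij by (subst index_mat_adjoint) auto
  also have "\<dots> = (\<Sum>k<m. cnj (A $$ (j, k)) * cnj (B $$ (k, i)))"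
    using assms ij by (subst index_mult_mat_sum[where n = n and m = m and p = p]) auto
  also have "\<dots> = (\<Sum>k<m. mat_adjoint B $$ (i, k) * mat_adjoint A $$ (k, j))"
    using assms ij by (intro sum.cong) auto
  also have "\<dots> = (mat_adjoint B * mat_adjoint A) $$ (i, j)"
    using assms ij by (subst index_mult_mat_sum[where n = p and m = m and p = n]) auto
  finally show "mat_adjoint (A * B) $$ (i, j) = (mat_adjoint B * mat_adjoint A) $$ (i, j)" .
qed (use assms in auto)

lemma mat_adjoint_one [simp]: "mat_adjoint (1\<^sub>m n) = (1\<^sub>m n :: complex mat)"
  by (rule eq_matI) auto

lemma mat_trace_mult:
  assumes "A \<in> carrier_mat n m" "B \<in> carrier_mat m n"
  shows "mat_trace (A * B) = (\<Sum>k<n. \<Sum>l<m. A $$ (k, l) * B $$ (l, k))"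
  unfolding mat_trace_def using assms
  by (auto intro!: sum.cong simp: index_mult_mat_sum simp del: index_mult_mat(1))

lemma mat_trace_commute:
  assumes "A \<in> carrier_mat n m" "B \<in> carrier_mat m n"
  shows "mat_trace (A * B) = mat_trace (B * A)"
  unfolding mat_trace_mult[OF assms] mat_trace_mult[OF assms(2,1)]
  by (subst sum.swap) (simp add: mult.commute)

lemma unitary_matD:
  assumes "unitary_mat n V"
  shows "V \<in> carrier_mat n n" "mat_adjoint V \<in> carrier_mat n n"
    "mat_adjoint V * V = 1\<^sub>m n" "V * mat_adjoint V = 1\<^sub>m n"
  using assms unfolding unitary_mat_def by auto

text \<open>A one-sided inverse of a square matrix is two-sided, so half of the definition
  suffices.\<close>

lemma unitary_matI:
  assumes "V \<in> carrier_mat n n" "mat_adjoint V * V = 1\<^sub>m n"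
  shows "unitary_mat n V"
  using assms mat_mult_left_right_inverse[of "mat_adjoint V" n V] unfolding unitary_mat_def by auto

lemma unitary_mat_adjoint: "unitary_mat n V \<Longrightarrow> unitary_mat n (mat_adjoint V)"
  unfolding unitary_mat_def by auto

lemma unitary_mat_mult:
  assumes "unitary_mat n U" "unitary_mat n V"
  shows "unitary_mat n (U * V)"
proof (rule unitary_matI)
  note U = unitary_matD[OF assms(1)] and V = unitary_matD[OF assms(2)]
  show "U * V \<in> carrier_mat n n" using U V by auto
  have "mat_adjoint (U * V) * (U * V) = mat_adjoint V * (mat_adjoint U * U) * V"
    using U(1,2) V(1,2) by (simp add: mat_adjoint_mult assoc_mult_mat[of _ n n _ n _ n]
        mult_carrier_mat[of _ n n _ n])
  thus "mat_adjoint (U * V) * (U * V) = 1\<^sub>m n" using U V by simp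
qed

section \<open>Diagonalized matrices and the functional calculus\<close>

definition spectral :: "nat \<Rightarrow> complex mat \<Rightarrow> (nat \<Rightarrow> real) \<Rightarrow> complex mat" where
  "spectral n V x = V * mat_diag n (\<lambda>k. complex_of_real (x k)) * mat_adjoint V"

lemma spectral_carrier: "V \<in> carrier_mat n n \<Longrightarrow> spectral n V x \<in> carrier_mat n n"
  unfolding spectral_def by (intro mult_carrier_mat) auto

lemma spectral_index:
  assumes "V \<in> carrier_mat n n" "i < n" "j < n"
  shows "spectral n V x $$ (i, j) = (\<Sum>k<n. of_real (x k) * V $$ (i, k) * cnj (V $$ (j, k)))"
proof -
  have "V * mat_diag n (\<lambda>k. complex_of_real (x k)) \<in> carrier_mat n n" using assms by auto
  thus ?thesis unfolding spectral_def using assms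
    by (subst index_mult_mat_sum[where n = n and m = n and p = n])
       (auto simp: mat_diag_mult_right intro!: sum.cong)
qed

lemma spectral_one: "unitary_mat n V \<Longrightarrow> spectral n V (\<lambda>_. 1) = 1\<^sub>m n"
  using unitary_matD[of n V] by (simp add: spectral_def)

text \<open>Solves an equation for the conjugated matrix. The dimensions of \<open>Y\<close> are
  stated on the right because the second equation there does not force them.\<close>

lemma spectral_conj:
  assumes "unitary_mat n V" "X \<in> carrier_mat n n"
  shows "V * X * mat_adjoint V = Y \<longleftrightarrow> Y \<in> carrier_mat n n \<and> X = mat_adjoint V * Y * V"
proof -
  note V = unitary_matD[OF assms(1)] and X = assms(2)
  have 1: "mat_adjoint V * (V * X * mat_adjoint V) * V = X"
  proof -
    have "mat_adjoint V * (V * X * mat_adjoint V) * V = (mat_adjoint V * V) * X * (mat_adjoint V * V)"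
      using V(1,2) X by (simp add: assoc_mult_mat[of _ n n _ n _ n] mult_carrier_mat[of _ n n _ n])
    also have "\<dots> = X" unfolding V(3) using X by simp
    finally show ?thesis .
  qed
  have 2: "V * (mat_adjoint V * Y * V) * mat_adjoint V = Y" if "Y \<in> carrier_mat n n"
  proof -
    have "V * (mat_adjoint V * Y * V) * mat_adjoint V = (V * mat_adjoint V) * Y * (V * mat_adjoint V)"
      using V(1,2) that by (simp add: assoc_mult_mat[of _ n n _ n _ n] mult_carrier_mat[of _ n n _ n])
    also have "\<dots> = Y" unfolding V(4) using that by simp
    finally show ?thesis .
  qed
  have "V * X * mat_adjoint V \<in> carrier_mat n n"
    using V X by (intro mult_carrier_mat[of _ n n _ n]) auto
  thus ?thesis using 1 2 by metis
qed

lemma spectral_adjoint: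
  assumes "V \<in> carrier_mat n n"
  shows "mat_adjoint (spectral n V x) = spectral n V x"
  using assms
  by (intro eq_matI)
     (auto intro!: sum.cong simp: spectral_index carrier_matD[OF spectral_carrier[OF assms]])

lemma spectral_mult:
  assumes "unitary_mat n V"
  shows "spectral n V x * spectral n V y = spectral n V (\<lambda>k. x k * y k)"
proof -
  note V = unitary_matD[OF assms]
  let ?X = "mat_diag n (\<lambda>k. complex_of_real (x k))" and ?Y = "mat_diag n (\<lambda>k. complex_of_real (y k))"
  have "spectral n V x * spectral n V y = V * ?X * (mat_adjoint V * V) * ?Y * mat_adjoint V"
    unfolding spectral_def using V(1,2) mat_diag_dim[of n]
    by (simp add: assoc_mult_mat[of _ n n _ n _ n] mult_carrier_mat[of _ n n _ n] del: mat_diag_diag)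
  also have "\<dots> = V * (?X * ?Y) * mat_adjoint V"
    unfolding V(3) using V(1,2) right_mult_one_mat[OF mult_carrier_mat[OF V(1) mat_diag_dim]]
    by (simp add: assoc_mult_mat[of _ n n _ n _ n] mult_carrier_mat[of _ n n _ n] del: mat_diag_diag)
  finally show ?thesis by (simp add: spectral_def)
qed

text \<open>Cyclicity of the trace brings \<open>A\<close> into the basis \<open>V\<close>, and
  against a diagonal matrix only its diagonal survives. This is why an energy depends on populations
  alone.\<close>

lemma trace_spectral_mult:
  assumes "V \<in> carrier_mat n n" "A \<in> carrier_mat n n"
  shows "mat_trace (spectral n V x * A) = (\<Sum>k<n. of_real (x k) * (mat_adjoint V * A * V) $$ (k, k))"
proof -
  let ?X = "mat_diag n (\<lambda>k. complex_of_real (x k))"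
  have V: "V \<in> carrier_mat n n" "mat_adjoint V \<in> carrier_mat n n" using assms by auto
  have "spectral n V x * A = V * (?X * (mat_adjoint V * A))"
    unfolding spectral_def using V assms
    by (simp add: assoc_mult_mat[of _ n n _ n _ n] mult_carrier_mat[of _ n n _ n])
  also have "mat_trace \<dots> = mat_trace (?X * (mat_adjoint V * A) * V)"
    using V assms by (intro mat_trace_commute[of _ n n] mult_carrier_mat[of _ n n _ n]) auto
  also have "?X * (mat_adjoint V * A) * V = ?X * (mat_adjoint V * A * V)"
    using V assms
    by (simp add: assoc_mult_mat[of _ n n _ n _ n] mult_carrier_mat[of _ n n _ n])
  also have "mat_trace \<dots> = (\<Sum>k<n. of_real (x k) * (mat_adjoint V * A * V) $$ (k, k))"
  proof -
    have VAV: "mat_adjoint V * A * V \<in> carrier_mat n n" using V assms by auto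
    show ?thesis unfolding mat_trace_def mat_diag_mult_left[OF VAV] by simp
  qed
  finally show ?thesis .
qed

lemma trace_spectral:
  assumes "unitary_mat n V"
  shows "mat_trace (spectral n V x) = (\<Sum>k<n. of_real (x k))"
proof -
  note V = unitary_matD[OF assms]
  have "spectral n V x = spectral n V x * 1\<^sub>m n"
    by (rule right_mult_one_mat[symmetric, OF spectral_carrier[OF V(1)]])
  also have "mat_trace \<dots> = (\<Sum>k<n. of_real (x k) * (mat_adjoint V * 1\<^sub>m n * V) $$ (k, k))"
    by (rule trace_spectral_mult[OF V(1)]) simp
  also have "mat_adjoint V * 1\<^sub>m n * V = 1\<^sub>m n"
    unfolding right_mult_one_mat[OF V(2)] V(3) ..
  finally show ?thesis by simp
qed

text \<open>Both diagonalizations are related by the unitary \<open>W\<^sup>\<dagger> V\<close>, whose \<open>(i, j)\<close> entry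
  vanishes unless the eigenvalues \<open>y i\<close> and \<open>x j\<close> agree.\<close>

lemma spectral_fun_unique:
  assumes V: "unitary_mat n V" and W: "unitary_mat n W"
    and eq: "spectral n V x = spectral n W y"
  shows "spectral n V (\<lambda>k. f (x k)) = spectral n W (\<lambda>k. f (y k))"
proof -
  note v = unitary_matD[OF V] and w = unitary_matD[OF W]
  define U where "U = mat_adjoint W * V"
  have U: "U \<in> carrier_mat n n" unfolding U_def using v w by auto
  have VU: "V = W * U"
    unfolding U_def using v w by (simp flip: assoc_mult_mat[of _ n n _ n _ n])
  have UW: "mat_adjoint V = mat_adjoint U * mat_adjoint W"
    unfolding VU using w U by (intro mat_adjoint_mult) auto
  have UU: "unitary_mat n U" unfolding U_def by (intro unitary_mat_mult unitary_mat_adjoint V W)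
  note u = unitary_matD[OF UU]
  let ?D = "\<lambda>x. mat_diag n (\<lambda>k. complex_of_real (x k))"
  \<comment> \<open>Multiplying by \<open>U\<close> from the right removes the adjoint and leaves an
    intertwining relation, which \<open>ent\<close> reads entry by entry; in that form applying
    \<open>f\<close> to the eigenvalues is harmless.\<close>
  have key: "spectral n V g = spectral n W h \<longleftrightarrow> U * ?D g = ?D h * U" for g h
  proof -
    have "spectral n V g = W * (U * ?D g * mat_adjoint U) * mat_adjoint W"
      unfolding spectral_def UW
      by (subst VU, use w(1,2) u(1,2) in
        \<open>simp add: assoc_mult_mat[of _ n n _ n _ n] mult_carrier_mat[of _ n n _ n]\<close>)
    hence "spectral n V g = spectral n W h \<longleftrightarrow>
        W * (U * ?D g * mat_adjoint U) * mat_adjoint W = W * ?D h * mat_adjoint W"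
      by (simp add: spectral_def)
    also have "\<dots> \<longleftrightarrow> U * ?D g * mat_adjoint U = ?D h"
    proof -
      have UDU: "U * ?D g * mat_adjoint U \<in> carrier_mat n n"
        using u by (intro mult_carrier_mat[of _ n n _ n]) auto
      have WDW: "W * ?D h * mat_adjoint W \<in> carrier_mat n n"
        using w by (intro mult_carrier_mat[of _ n n _ n]) auto
      have "?D h = mat_adjoint W * (W * ?D h * mat_adjoint W) * W"
        using spectral_conj[OF W mat_diag_dim, of _ "W * ?D h * mat_adjoint W"] by blast
      thus ?thesis using spectral_conj[OF W UDU, of "W * ?D h * mat_adjoint W"] WDW by auto
    qed
    also have "\<dots> \<longleftrightarrow> U * ?D g = ?D h * U"
    proof
      have UD: "U * ?D g \<in> carrier_mat n n" using u by auto
      assume "U * ?D g * mat_adjoint U = ?D h"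
      hence "?D h * U = U * ?D g * mat_adjoint U * U" by simp
      also have "\<dots> = U * ?D g * (mat_adjoint U * U)" by (rule assoc_mult_mat[OF UD u(2,1)])
      also have "\<dots> = U * ?D g" unfolding u(3) by (rule right_mult_one_mat[OF UD])
      finally show "U * ?D g = ?D h * U" by simp
    next
      assume "U * ?D g = ?D h * U"
      hence "U * ?D g * mat_adjoint U = ?D h * U * mat_adjoint U" by simp
      also have "\<dots> = ?D h * (U * mat_adjoint U)" by (rule assoc_mult_mat[OF mat_diag_dim u(1,2)])
      also have "\<dots> = ?D h" unfolding u(4) by (rule right_mult_one_mat[OF mat_diag_dim])
      finally show "U * ?D g * mat_adjoint U = ?D h" .
    qed
    finally show ?thesis .
  qed
  have ent: "U * ?D g = ?D h * U \<longleftrightarrow>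
      (\<forall>i<n. \<forall>j<n. U $$ (i, j) * of_real (g j) = of_real (h i) * U $$ (i, j))" for g h
    unfolding mat_diag_mult_left[OF U] mat_diag_mult_right[OF U] mat_eq_iff by auto
  have "U * ?D x = ?D y * U" using eq key by blast
  hence "\<forall>i<n. \<forall>j<n. U $$ (i, j) = 0 \<or> x j = y i"
    unfolding ent by (metis mult.commute mult_cancel_left of_real_eq_iff)
  hence "U * ?D (\<lambda>k. f (x k)) = ?D (\<lambda>k. f (y k)) * U"
    unfolding ent by (metis mult.commute mult_zero_left)
  thus ?thesis using key by blast
qed

text \<open>Uniqueness, just proved, is what the definite description needs; any diagonalization may
  now be used to evaluate \<open>herm_fun\<close>.\<close>

lemma herm_fun_spectral:
  assumes V: "unitary_mat n V"
  shows "herm_fun f (spectral n V x) = spectral n V (\<lambda>k. f (x k))"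
proof -
  have dim: "dim_row (spectral n V x) = n"
    using spectral_carrier unitary_matD(1)[OF V] by blast
  show ?thesis unfolding herm_fun_def dim spectral_def[symmetric]
  proof (rule the_equality)
    show "\<exists>W y. unitary_mat n W \<and> spectral n V x = spectral n W y \<and>
        spectral n V (\<lambda>k. f (x k)) = spectral n W (\<lambda>k. f (y k))"
      using V by blast
  next
    fix F assume "\<exists>W y. unitary_mat n W \<and> spectral n V x = spectral n W y \<and>
        F = spectral n W (\<lambda>k. f (y k))"
    thus "F = spectral n V (\<lambda>k. f (x k))" using spectral_fun_unique[OF V] by metis
  qed
qed

lemma vn_entropy_spectral:
  assumes "unitary_mat n V"
  shows "vn_entropy (spectral n V x) = - (\<Sum>k<n. x k * log 2 (x k))"
  unfolding vn_entropy_def herm_fun_spectral[OF assms] spectral_mult[OF assms] trace_spectral[OF assms]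
  by simp

lemma spectral_mult_left:
  assumes "U \<in> carrier_mat n n" "V \<in> carrier_mat n n"
  shows "spectral n (U * V) x = U * spectral n V x * mat_adjoint U"
proof -
  have "mat_adjoint (U * V) = mat_adjoint V * mat_adjoint U" using assms by (rule mat_adjoint_mult)
  thus ?thesis unfolding spectral_def using assms
    by (simp add: assoc_mult_mat[of _ n n _ n _ n] mult_carrier_mat[of _ n n _ n])
qed

section \<open>The spectral theorem for Hermitian matrices\<close>

lemma adjoint_mult_self_index:
  fixes V :: "complex mat"
  assumes "V \<in> carrier_mat n n" "i < n" "j < n"
  shows "(mat_adjoint V * V) $$ (i, j) = (\<Sum>k<n. cnj (V $$ (k, i)) * V $$ (k, j))"
  using assms by (subst index_mult_mat_sum[where n = n and m = n and p = n]) auto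

lemma unitary_mat_iff_columns:
  "unitary_mat n V \<longleftrightarrow> V \<in> carrier_mat n n \<and>
     (\<forall>i<n. \<forall>j<n. (\<Sum>k<n. cnj (V $$ (k, i)) * V $$ (k, j)) = (if i = j then 1 else 0))"
proof (cases "V \<in> carrier_mat n n")
  case True
  hence "mat_adjoint V * V = 1\<^sub>m n \<longleftrightarrow>
      (\<forall>i<n. \<forall>j<n. (mat_adjoint V * V) $$ (i, j) = (if i = j then 1 else 0))"
    by (subst mat_eq_iff) (auto simp del: index_mult_mat(1))
  also have "\<dots> \<longleftrightarrow>
      (\<forall>i<n. \<forall>j<n. (\<Sum>k<n. cnj (V $$ (k, i)) * V $$ (k, j)) = (if i = j then 1 else 0))"
    by (auto simp: adjoint_mult_self_index[OF True] simp del: index_mult_mat(1))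
  finally show ?thesis using True unitary_matI[OF True] unitary_matD(3)[of n V] by blast
qed (simp add: unitary_mat_def)

text \<open>Complete \<open>v\<close> to a basis and orthogonalize; Gram-Schmidt keeps the first
  vector. Its output is orthogonal but not normalized, so each column is divided by its norm, the
  square root of \<open>r j\<close>, and \<open>c\<close> is the factor of column 0.\<close>

lemma unitary_mat_first_column:
  fixes v :: "complex vec"
  assumes v: "v \<in> carrier_vec n" "v \<noteq> 0\<^sub>v n"
  obtains W c where "unitary_mat n W" "\<And>i. i < n \<Longrightarrow> W $$ (i, 0) = c * v $ i"
proof -
  interpret cof_vec_space n "TYPE(complex)" .
  define b where "b = basis_completion v"
  define ws where "ws = gram_schmidt n b"
  have n: "n > 0" using v by (cases n) auto
  note bc = basis_completion[OF v, folded b_def]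
  obtain vs where bv: "b = v # vs" using bc(6,7) n by (cases b) auto
  have ws: "set ws \<subseteq> carrier_vec n" "corthogonal ws" "length ws = n"
    using gram_schmidt_result[OF bc(2,4,5) refl, folded ws_def] bc(6) by auto
  have hd: "ws ! 0 = v"
    using gram_schmidt_hd[OF v(1), of vs, folded bv ws_def] ws(3) n by (cases ws) auto
  have car: "ws ! i \<in> carrier_vec n" if "i < n" for i using ws that by auto
  define r where "r i = (\<Sum>k<n. (cmod (ws ! i $ k))\<^sup>2)" for i
  have ip: "ws ! j \<bullet>c ws ! i = (\<Sum>k<n. cnj (ws ! i $ k) * ws ! j $ k)" if "i < n" "j < n" for i j
    using car[OF that(1)] car[OF that(2)]
    by (auto simp: scalar_prod_def conjugate_complex_def lessThan_atLeast0 mult.commute intro!: sum.cong)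
  have ipr: "ws ! i \<bullet>c ws ! i = of_real (r i)" if "i < n" for i
    unfolding ip[OF that that] r_def of_real_sum
    by (intro sum.cong refl) (simp only: mult.commute[of "cnj _"] complex_norm_square)
  have r: "r i > 0" if "i < n" for i
  proof -
    have "r i \<noteq> 0" using corthogonalD[OF ws(2), of i i] ipr that ws(3) by auto
    moreover have "r i \<ge> 0" unfolding r_def by (intro sum_nonneg) auto
    ultimately show ?thesis by simp
  qed
  define W where "W = mat n n (\<lambda>(i, j). of_real (1 / sqrt (r j)) * ws ! j $ i)"
  have "unitary_mat n W" unfolding unitary_mat_iff_columns
  proof (intro conjI allI impI)
    show "W \<in> carrier_mat n n" by (simp add: W_def)
    fix i j assume ij: "i < n" "j < n"
    have "(\<Sum>k<n. cnj (W $$ (k, i)) * W $$ (k, j)) =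
        of_real (1 / sqrt (r i) * (1 / sqrt (r j))) * (ws ! j \<bullet>c ws ! i)"
      unfolding ip[OF ij] sum_distrib_left using ij by (intro sum.cong) (auto simp: W_def)
    also have "\<dots> = (if i = j then 1 else 0)"
    proof (cases "i = j")
      case True
      have "1 / sqrt (r i) * (1 / sqrt (r i)) * r i = 1" using r[OF ij(1)] by (simp add: field_simps)
      thus ?thesis using True ipr[OF ij(1)] by (metis of_real_1 of_real_mult)
    next
      case False
      thus ?thesis using corthogonalD[OF ws(2), of j i] ij ws(3) by auto
    qed
    finally show "(\<Sum>k<n. cnj (W $$ (k, i)) * W $$ (k, j)) = (if i = j then 1 else 0)" .
  qed
  moreover have "W $$ (i, 0) = of_real (1 / sqrt (r 0)) * v $ i" if "i < n" for i
    using that n by (simp add: W_def hd)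
  ultimately show thesis by (rule that)
qed

text \<open>Over the complex numbers the characteristic polynomial splits; its first linear factor
  provides the eigenvalue.\<close>

lemma complex_mat_has_eigenvector:
  fixes A :: "complex mat"
  assumes "A \<in> carrier_mat n n" "n > 0"
  obtains v e where "v \<in> carrier_vec n" "v \<noteq> 0\<^sub>v n" "A *\<^sub>v v = e \<cdot>\<^sub>v v"
proof -
  obtain as where as: "char_poly A = (\<Prod>a\<leftarrow>as. [:- a, 1:])" "length as = n"
    using char_poly_factorized[OF assms(1)] by auto
  then obtain e es where "as = e # es" using assms(2) by (cases as) auto
  hence "poly (char_poly A) e = 0" using as by simp
  hence "eigenvalue A e" using eigenvalue_root_char_poly[OF assms(1)] by simp
  thus thesis using that assms(1) unfolding eigenvalue_def eigenvector_def by auto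
qed

text \<open>Deflation: a unitary moves an eigenvector to the first basis vector, Hermiticity clears
  the first row together with the first column, and the remaining block falls to the induction
  hypothesis.\<close>

lemma spectral_theorem:
  assumes "A \<in> carrier_mat n n" "mat_adjoint A = A"
  obtains V x where "unitary_mat n V" "A = spectral n V x"
proof -
  have "\<exists>V x. unitary_mat n V \<and> A = spectral n V x"
    using assms
  proof (induction n arbitrary: A)
    case 0
    hence "unitary_mat 0 (1\<^sub>m 0) \<and> A = spectral 0 (1\<^sub>m 0) (\<lambda>_. 0)"
      by (auto simp: unitary_mat_def spectral_def mat_eq_iff)
    thus ?case by blast
  next
    case (Suc n)
    let ?n = "Suc n"
    note A = Suc.prems(1)
    obtain v e where v: "v \<in> carrier_vec ?n" "v \<noteq> 0\<^sub>v ?n" "A *\<^sub>v v = e \<cdot>\<^sub>v v"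
      using complex_mat_has_eigenvector[OF A] by auto
    obtain W c where W: "unitary_mat ?n W" and Wv: "\<And>i. i < ?n \<Longrightarrow> W $$ (i, 0) = c * v $ i"
      using unitary_mat_first_column[OF v(1,2)] by blast
    note w = unitary_matD[OF W]
    define A' where "A' = mat_adjoint W * A * W"
    have A': "A' \<in> carrier_mat ?n ?n" unfolding A'_def using w A by auto
    have herm: "mat_adjoint A' = A'"
    proof -
      have "mat_adjoint A' = mat_adjoint W * mat_adjoint (mat_adjoint W * A)"
        unfolding A'_def using w A by (intro mat_adjoint_mult) auto
      also have "mat_adjoint (mat_adjoint W * A) = mat_adjoint A * mat_adjoint (mat_adjoint W)"
        using w A by (intro mat_adjoint_mult) auto
      finally have "mat_adjoint A' = mat_adjoint W * (A * W)"
        by (simp only: Suc.prems(2) mat_adjoint_adjoint)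
      also have "\<dots> = A'" unfolding A'_def
        by (rule assoc_mult_mat[symmetric]) (use w A in auto)
      finally show ?thesis .
    qed
    have sym: "A' $$ (i, j) = cnj (A' $$ (j, i))" if "i < ?n" "j < ?n" for i j
      using that A' index_mat_adjoint[of i A' j] by (simp add: herm)
    \<comment> \<open>Column 0 of \<open>W\<close> is a multiple of the eigenvector, so
      \<open>A\<close> scales it by \<open>e\<close>; orthonormality of the columns of
      \<open>W\<close> then leaves \<open>e\<close> in the first place and 0 elsewhere.\<close>
    have col0: "A' $$ (i, 0) = (if i = 0 then e else 0)" if i: "i < ?n" for i
    proof -
      have AW: "(A * W) $$ (k, 0) = e * W $$ (k, 0)" if k: "k < ?n" for k
      proof -
        have "(A * W) $$ (k, 0) = (\<Sum>l<?n. A $$ (k, l) * W $$ (l, 0))"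
          using A w k by (intro index_mult_mat_sum) auto
        also have "\<dots> = c * (\<Sum>l<?n. A $$ (k, l) * v $ l)"
          unfolding sum_distrib_left by (intro sum.cong) (auto simp: Wv)
        also have "(\<Sum>l<?n. A $$ (k, l) * v $ l) = (A *\<^sub>v v) $ k"
          using A v(1) k by (auto simp: scalar_prod_def lessThan_atLeast0 intro!: sum.cong)
        also have "c * (A *\<^sub>v v) $ k = e * W $$ (k, 0)"
          using v k by (simp add: v(3) Wv)
        finally show ?thesis .
      qed
      have "A' = mat_adjoint W * (A * W)"
        unfolding A'_def using w A by (intro assoc_mult_mat) auto
      hence "A' $$ (i, 0) = (\<Sum>k<?n. mat_adjoint W $$ (i, k) * (A * W) $$ (k, 0))"
        using i A w by (simp only:) (intro index_mult_mat_sum, auto)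
      also have "\<dots> = e * (\<Sum>k<?n. cnj (W $$ (k, i)) * W $$ (k, 0))"
        unfolding sum_distrib_left using w i
        by (intro sum.cong) (auto simp: AW simp del: index_mult_mat(1))
      also have "\<dots> = (if i = 0 then e else 0)"
        using W i unfolding unitary_mat_iff_columns by auto
      finally show ?thesis .
    qed
    have row0: "A' $$ (0, j) = (if j = 0 then e else 0)" if "j < ?n" for j
      using sym[of 0 j] sym[of 0 0] col0[OF that] col0[of 0] that by auto
    \<comment> \<open>A diagonal entry of a Hermitian matrix is real, so \<open>e\<close> may enter
      the real vector \<open>x\<close>.\<close>
    have e: "of_real (Re e) = e"
      using sym[of 0 0] col0[of 0] by (simp add: complex_eq_iff)
    define A3 where "A3 = mat n n (\<lambda>(i, j). A' $$ (Suc i, Suc j))"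
    have "A3 \<in> carrier_mat n n" by (simp add: A3_def)
    moreover have "mat_adjoint A3 = A3"
    proof (rule eq_matI)
      fix i j assume "i < dim_row A3" "j < dim_col A3"
      hence ij: "i < n" "j < n" by (auto simp: A3_def)
      thus "mat_adjoint A3 $$ (i, j) = A3 $$ (i, j)"
        using sym[of "Suc i" "Suc j"] by (simp add: A3_def)
    qed (auto simp: A3_def)
    ultimately obtain V3 x3 where V3: "unitary_mat n V3" and A3: "A3 = spectral n V3 x3"
      using Suc.IH by blast
    note v3 = unitary_matD[OF V3]
    \<comment> \<open>\<open>F\<close> is the block sum of 1 and \<open>V3\<close>, and
      \<open>x\<close> puts the new eigenvalue before the old ones; hence the index shift by
      one.\<close>
    define F where "F = mat ?n ?n (\<lambda>(i, j). if i = 0 \<or> j = 0 then (if i = j then 1 else 0)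
      else V3 $$ (i - 1, j - 1))"
    define x where "x k = (case k of 0 \<Rightarrow> Re e | Suc k \<Rightarrow> x3 k)" for k
    have F: "F \<in> carrier_mat ?n ?n" by (simp add: F_def)
    have F_ix: "F $$ (0, 0) = 1" "\<And>i. i < n \<Longrightarrow> F $$ (Suc i, 0) = 0"
      "\<And>j. j < n \<Longrightarrow> F $$ (0, Suc j) = 0"
      "\<And>i j. i < n \<Longrightarrow> j < n \<Longrightarrow> F $$ (Suc i, Suc j) = V3 $$ (i, j)"
      by (auto simp: F_def)
    have UF: "unitary_mat ?n F" unfolding unitary_mat_iff_columns
    proof (intro conjI allI impI F)
      fix i j assume "i < ?n" "j < ?n"
      thus "(\<Sum>k<?n. cnj (F $$ (k, i)) * F $$ (k, j)) = (if i = j then 1 else 0)"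
        using V3 unfolding unitary_mat_iff_columns sum.lessThan_Suc_shift
        by (cases i; cases j) (auto simp: F_ix)
    qed
    have "A' = spectral ?n F x"
    proof (rule eq_matI)
      fix i j assume "i < dim_row (spectral ?n F x)" "j < dim_col (spectral ?n F x)"
      hence ij: "i < ?n" "j < ?n" using carrier_matD[OF spectral_carrier[OF F]] by auto
      have A3ij: "A' $$ (Suc i, Suc j) = (\<Sum>k<n. of_real (x3 k) * V3 $$ (i, k) * cnj (V3 $$ (j, k)))"
        if "i < n" "j < n" for i j
        using that spectral_index[OF v3(1), of i j x3] by (simp add: A3[symmetric] A3_def)
      show "A' $$ (i, j) = spectral ?n F x $$ (i, j)"
        unfolding spectral_index[OF F ij] sum.lessThan_Suc_shift using ij
        by (cases i; cases j) (auto simp: F_ix x_def e row0 col0 A3ij)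
    qed (use A' carrier_matD[OF spectral_carrier[OF F]] in auto)
    hence "A = W * spectral ?n F x * mat_adjoint W"
      using spectral_conj[OF W A', of A] A A'_def by metis
    hence "A = spectral ?n (W * F) x" using spectral_mult_left[OF w(1) F] by simp
    thus ?case using unitary_mat_mult[OF W UF] by blast
  qed
  thus thesis using that by blast
qed

section \<open>Tensor products and marginals\<close>

lemma tot_dim_Suc: "tot_dim d (Suc N) = tot_dim d N * d N"
  by (simp add: tot_dim_def)

lemma tot_dim_pos: "(\<And>i. i < N \<Longrightarrow> 1 \<le> d i) \<Longrightarrow> tot_dim d N > 0"
  unfolding tot_dim_def by (intro prod_pos) (simp add: Suc_le_eq)

lemma digit_less: "1 \<le> d i \<Longrightarrow> digit d i k < d i"
  by (simp add: digit_def)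

lemma digit_last:
  assumes "r < tot_dim d N" "q < d N"
  shows "digit d N (r + tot_dim d N * q) = q"
  using assms by (simp add: digit_def flip: tot_dim_def)

text \<open>For \<open>i < N\<close> the number \<open>tot_dim d N\<close> is a multiple of
  \<open>d 0 * ... * d i\<close>, so adding multiples of it changes the quotient in
  \<open>digit\<close> by a multiple of \<open>d i\<close>. With \<open>digit_last\<close> this lets
  inductions on \<open>N\<close> peel off the most significant digit.\<close>

lemma digit_add_tot_dim:
  assumes "i < N" "tot_dim d N > 0"
  shows "digit d i (r + tot_dim d N * q) = digit d i r"
proof -
  let ?P = "\<Prod>j<i. d j"
  have split: "{..<N} = {..<Suc i} \<union> {Suc i..<N}" using assms by auto
  have "tot_dim d N = prod d ({..<Suc i} \<union> {Suc i..<N})"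
    unfolding tot_dim_def by (rule arg_cong[OF split])
  also have "\<dots> = (\<Prod>j<Suc i. d j) * (\<Prod>j\<in>{Suc i..<N}. d j)"
    by (rule prod.union_disjoint) auto
  finally have "tot_dim d N = ?P * (d i * (\<Prod>j\<in>{Suc i..<N}. d j))" by simp
  then obtain c where c: "tot_dim d N = ?P * (d i * c)" by blast
  have P: "?P > 0" using assms(2) unfolding c nat_0_less_mult_iff by (rule conjunct1)
  have "(r + tot_dim d N * q) div ?P = (r + ?P * (d i * (c * q))) div ?P"
    unfolding c by (simp only: mult.assoc)
  also have "\<dots> = r div ?P + d i * (c * q)"
    using P by (intro div_mult_self2[THEN trans]) auto
  finally show ?thesis by (simp add: digit_def)
qed

lemma sum_tot_dim_Suc:
  "(\<Sum>k<tot_dim d (Suc N). g k) = (\<Sum>q<d N. \<Sum>r<tot_dim d N. g (r + tot_dim d N * q))"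
  for g :: "nat \<Rightarrow> 'a :: comm_monoid_add"
proof -
  let ?D = "tot_dim d N"
  have "(\<Sum>k<tot_dim d (Suc N). g k) = (\<Sum>q<d N. sum g {q * ?D..<q * ?D + ?D})"
    by (simp add: sum.nat_group tot_dim_Suc mult.commute)
  also have "\<dots> = (\<Sum>q<d N. \<Sum>r<?D. g (r + ?D * q))"
  proof (rule sum.cong[OF refl])
    fix q
    have "sum g {q * ?D..<q * ?D + ?D} = sum g {0 + q * ?D..<?D + q * ?D}" by (simp add: add.commute)
    also have "\<dots> = (\<Sum>r<?D. g (r + ?D * q))"
      unfolding sum.shift_bounds_nat_ivl by (simp add: lessThan_atLeast0 mult.commute)
    finally show "sum g {q * ?D..<q * ?D + ?D} = (\<Sum>r<?D. g (r + ?D * q))" .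
  qed
  finally show ?thesis .
qed

text \<open>The distributive law, read through the numbering. Products of tensors, partition
  functions and product distributions all factorize by it.\<close>

lemma sum_prod_digits:
  fixes f :: "nat \<Rightarrow> nat \<Rightarrow> 'a :: comm_semiring_1"
  shows "(\<Sum>k<tot_dim d N. \<Prod>i<N. f i (digit d i k)) = (\<Prod>i<N. \<Sum>a<d i. f i a)"
proof (induction N)
  case 0
  show ?case by (simp add: tot_dim_def)
next
  case (Suc N)
  let ?D = "tot_dim d N"
  have "(\<Sum>k<tot_dim d (Suc N). \<Prod>i<Suc N. f i (digit d i k)) =
      (\<Sum>q<d N. \<Sum>r<?D. \<Prod>i<Suc N. f i (digit d i (r + ?D * q)))"
    by (rule sum_tot_dim_Suc)
  also have "\<dots> = (\<Sum>q<d N. \<Sum>r<?D. (\<Prod>i<N. f i (digit d i r)) * f N q)"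
    by (intro sum.cong refl) (simp add: digit_last digit_add_tot_dim)
  also have "\<dots> = (\<Sum>r<?D. \<Prod>i<N. f i (digit d i r)) * (\<Sum>q<d N. f N q)"
    by (simp add: sum_product sum.swap[of _ "{..<d N}"])
  finally show ?case using Suc by simp
qed

text \<open>Injectivity of the digit expansion; it makes the off-diagonal entries vanish in
  \<open>tensor_diag\<close>, where two different indices differ in some digit.\<close>

lemma digits_eq_iff:
  assumes "k < tot_dim d N" "l < tot_dim d N"
  shows "(\<forall>i<N. digit d i k = digit d i l) \<longleftrightarrow> k = l"
  using assms
proof (induction N arbitrary: k l)
  case 0
  thus ?case by (simp add: tot_dim_def)
next
  case (Suc N)
  let ?D = "tot_dim d N"
  have D: "?D > 0" using Suc.prems by (cases "?D = 0") (auto simp: tot_dim_Suc)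
  have dec: "\<exists>r q. k = r + ?D * q \<and> r < ?D \<and> q < d N" if "k < tot_dim d (Suc N)" for k
    using that D by (intro exI[of _ "k mod ?D"] exI[of _ "k div ?D"])
      (auto simp: tot_dim_Suc less_mult_imp_div_less mult.commute)
  obtain r q where k: "k = r + ?D * q" "r < ?D" "q < d N" using dec[OF Suc.prems(1)] by blast
  obtain s p where l: "l = s + ?D * p" "s < ?D" "p < d N" using dec[OF Suc.prems(2)] by blast
  have "(\<forall>i<Suc N. digit d i k = digit d i l) \<longleftrightarrow> (\<forall>i<N. digit d i r = digit d i s) \<and> q = p"
    using k l D by (auto simp: less_Suc_eq digit_last digit_add_tot_dim)
  also have "\<dots> \<longleftrightarrow> k = l"
  proof -
    have "k = l \<Longrightarrow> r = s \<and> q = p"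
    proof
      assume "k = l"
      hence "k mod ?D = l mod ?D" "k div ?D = l div ?D" by auto
      thus "r = s" "q = p" using k l by auto
    qed
    thus ?thesis using Suc.IH[OF k(2) l(2)] k l by auto
  qed
  finally show ?case .
qed

section \<open>Tensor products and local operators in a product basis\<close>

lemma tensor_carrier [simp]: "tensor d N A \<in> carrier_mat (tot_dim d N) (tot_dim d N)"
  by (simp add: tensor_def)

lemma tensor_index:
  "k < tot_dim d N \<Longrightarrow> l < tot_dim d N \<Longrightarrow>
    tensor d N A $$ (k, l) = (\<Prod>i<N. A i $$ (digit d i k, digit d i l))"
  by (simp add: tensor_def)

lemma tensor_cong: "(\<And>i. i < N \<Longrightarrow> A i = A' i) \<Longrightarrow> tensor d N A = tensor d N A'"
  by (auto simp: tensor_def intro!: eq_matI prod.cong)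

lemma tensor_mult:
  assumes d: "\<And>i. i < N \<Longrightarrow> 1 \<le> d i"
    and "\<And>i. i < N \<Longrightarrow> A i \<in> carrier_mat (d i) (d i)" "\<And>i. i < N \<Longrightarrow> C i \<in> carrier_mat (d i) (d i)"
  shows "tensor d N A * tensor d N C = tensor d N (\<lambda>i. A i * C i)"
proof (rule eq_matI)
  fix k l assume "k < dim_row (tensor d N (\<lambda>i. A i * C i))" "l < dim_col (tensor d N (\<lambda>i. A i * C i))"
  hence kl: "k < tot_dim d N" "l < tot_dim d N" by (auto simp: tensor_def)
  have "(tensor d N A * tensor d N C) $$ (k, l) = (\<Sum>m<tot_dim d N. \<Prod>i<N.
      A i $$ (digit d i k, digit d i m) * C i $$ (digit d i m, digit d i l))"
    using kl by (subst index_mult_mat_sum[OF tensor_carrier tensor_carrier])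
      (auto simp: tensor_index prod.distrib)
  also have "\<dots> = (\<Prod>i<N. \<Sum>a<d i. A i $$ (digit d i k, a) * C i $$ (a, digit d i l))"
    by (rule sum_prod_digits)
  also have "\<dots> = (\<Prod>i<N. (A i * C i) $$ (digit d i k, digit d i l))"
  proof (intro prod.cong refl)
    fix i assume "i \<in> {..<N}"
    hence i: "i < N" by simp
    show "(\<Sum>a<d i. A i $$ (digit d i k, a) * C i $$ (a, digit d i l)) =
        (A i * C i) $$ (digit d i k, digit d i l)"
      by (rule index_mult_mat_sum[symmetric, OF assms(2,3)[OF i] digit_less[of d i, OF d[OF i]]
            digit_less[of d i, OF d[OF i]]])
  qed
  finally show "(tensor d N A * tensor d N C) $$ (k, l) = tensor d N (\<lambda>i. A i * C i) $$ (k, l)"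
    using kl by (simp add: tensor_index)
qed (auto simp: tensor_def)

lemma tensor_adjoint:
  assumes d: "\<And>i. i < N \<Longrightarrow> 1 \<le> d i"
    and "\<And>i. i < N \<Longrightarrow> A i \<in> carrier_mat (d i) (d i)"
  shows "mat_adjoint (tensor d N A) = tensor d N (\<lambda>i. mat_adjoint (A i))"
proof (rule eq_matI)
  fix k l assume "k < dim_row (tensor d N (\<lambda>i. mat_adjoint (A i)))"
    "l < dim_col (tensor d N (\<lambda>i. mat_adjoint (A i)))"
  hence kl: "k < tot_dim d N" "l < tot_dim d N" by (auto simp: tensor_def)
  thus "mat_adjoint (tensor d N A) $$ (k, l) = tensor d N (\<lambda>i. mat_adjoint (A i)) $$ (k, l)"
    using assms digit_less[of d]
    by (auto simp: tensor_index carrier_matD[OF tensor_carrier] carrier_matD[OF assms(2)]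
        intro!: prod.cong)
qed (auto simp: tensor_def)

lemma tensor_diag:
  assumes d: "\<And>i. i < N \<Longrightarrow> 1 \<le> d i"
  shows "tensor d N (\<lambda>i. mat_diag (d i) (x i)) =
    mat_diag (tot_dim d N) (\<lambda>k. \<Prod>i<N. x i (digit d i k))"
proof (rule eq_matI)
  let ?R = "mat_diag (tot_dim d N) (\<lambda>k. \<Prod>i<N. x i (digit d i k))"
  fix k l assume "k < dim_row ?R" "l < dim_col ?R"
  hence kl: "k < tot_dim d N" "l < tot_dim d N" by (auto simp: mat_diag_def)
  have "tensor d N (\<lambda>i. mat_diag (d i) (x i)) $$ (k, l) =
      (\<Prod>i<N. if digit d i k = digit d i l then x i (digit d i l) else 0)"
    unfolding tensor_index[OF kl]
    by (intro prod.cong refl) (use digit_less[of d] d in \<open>auto simp: mat_diag_def\<close>)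
  also have "\<dots> = (if k = l then \<Prod>i<N. x i (digit d i l) else 0)"
  proof (cases "k = l")
    case False
    then obtain i where "i < N" "digit d i k \<noteq> digit d i l" using digits_eq_iff[OF kl] by auto
    thus ?thesis using False by (intro prod_zero[THEN trans]) auto
  qed simp
  also have "\<dots> = ?R $$ (k, l)" using kl by (simp add: mat_diag_def)
  finally show "tensor d N (\<lambda>i. mat_diag (d i) (x i)) $$ (k, l) = ?R $$ (k, l)" .
qed (auto simp: tensor_def mat_diag_def)

lemma tensor_one:
  assumes "\<And>i. i < N \<Longrightarrow> 1 \<le> d i"
  shows "tensor d N (\<lambda>i. 1\<^sub>m (d i)) = 1\<^sub>m (tot_dim d N)"
  using tensor_diag[of N d "\<lambda>_ _. 1"] assms by simp

lemma unitary_tensor: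
  assumes d: "\<And>i. i < N \<Longrightarrow> 1 \<le> d i" and B: "\<And>i. i < N \<Longrightarrow> unitary_mat (d i) (B i)"
  shows "unitary_mat (tot_dim d N) (tensor d N B)"
proof (rule unitary_matI[OF tensor_carrier])
  have "mat_adjoint (tensor d N B) * tensor d N B = tensor d N (\<lambda>i. mat_adjoint (B i) * B i)"
    using unitary_matD[OF B] d by (simp add: tensor_adjoint tensor_mult)
  also have "\<dots> = tensor d N (\<lambda>i. 1\<^sub>m (d i))"
    using unitary_matD[OF B] by (intro tensor_cong) auto
  finally show "mat_adjoint (tensor d N B) * tensor d N B = 1\<^sub>m (tot_dim d N)"
    using tensor_one d by auto
qed

lemma tensor_spectral:
  assumes d: "\<And>i. i < N \<Longrightarrow> 1 \<le> d i" and B: "\<And>i. i < N \<Longrightarrow> B i \<in> carrier_mat (d i) (d i)"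
  shows "tensor d N (\<lambda>i. spectral (d i) (B i) (x i)) =
    spectral (tot_dim d N) (tensor d N B) (\<lambda>k. \<Prod>i<N. x i (digit d i k))"
proof -
  have "spectral (tot_dim d N) (tensor d N B) (\<lambda>k. \<Prod>i<N. x i (digit d i k)) =
      tensor d N B * tensor d N (\<lambda>i. mat_diag (d i) (\<lambda>k. complex_of_real (x i k))) *
      tensor d N (\<lambda>i. mat_adjoint (B i))"
    unfolding spectral_def using d B by (subst tensor_diag) (auto simp: tensor_adjoint)
  also have "\<dots> = tensor d N (\<lambda>i. spectral (d i) (B i) (x i))"
  proof -
    have "B i * mat_diag (d i) (\<lambda>k. complex_of_real (x i k)) \<in> carrier_mat (d i) (d i)"
      if "i < N" for i using B[OF that] by simp
    thus ?thesis unfolding spectral_def using d B by (simp add: tensor_mult)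
  qed
  finally show ?thesis ..
qed

text \<open>In every basis the identity is the spectral form with all eigenvalues 1, so the other
  factors can be written in their own bases \<open>B j\<close>. One product basis thus diagonalizes
  the local operators of all parties at once.\<close>

lemma local_op_spectral:
  assumes d: "\<And>i. i < N \<Longrightarrow> 1 \<le> d i" and B: "\<And>i. i < N \<Longrightarrow> unitary_mat (d i) (B i)"
    and i: "i < N"
  shows "local_op d N i (spectral (d i) (B i) x) =
    spectral (tot_dim d N) (tensor d N B) (\<lambda>k. x (digit d i k))"
proof -
  let ?x = "\<lambda>j. if j = i then x else (\<lambda>_. 1)"
  have "local_op d N i (spectral (d i) (B i) x) = tensor d N (\<lambda>j. spectral (d j) (B j) (?x j))"
    unfolding local_op_def by (intro tensor_cong) (auto simp: spectral_one[OF B])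
  also have "\<dots> = spectral (tot_dim d N) (tensor d N B) (\<lambda>k. \<Prod>j<N. ?x j (digit d j k))"
    using d unitary_matD(1)[OF B] by (intro tensor_spectral) auto
  also have "(\<lambda>k. \<Prod>j<N. ?x j (digit d j k)) = (\<lambda>k. x (digit d i k))"
  proof
    fix k
    have "(\<Prod>j<N. ?x j (digit d j k)) = (\<Prod>j<N. if j = i then x (digit d j k) else 1)"
      by (intro prod.cong) auto
    thus "(\<Prod>j<N. ?x j (digit d j k)) = x (digit d i k)" using i by simp
  qed
  finally show ?thesis .
qed

lemma total_ham_spectral:
  assumes d: "\<And>i. i < N \<Longrightarrow> 1 \<le> d i" and B: "\<And>i. i < N \<Longrightarrow> unitary_mat (d i) (B i)"
    and H: "\<And>i. i < N \<Longrightarrow> H i = spectral (d i) (B i) (h i)"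
  shows "total_ham d N H =
    spectral (tot_dim d N) (tensor d N B) (\<lambda>k. \<Sum>i<N. h i (digit d i k))"
proof (rule eq_matI)
  let ?D = "tot_dim d N"
  let ?S = "spectral ?D (tensor d N B) (\<lambda>k. \<Sum>i<N. h i (digit d i k))"
  note dims = carrier_matD[OF spectral_carrier[OF tensor_carrier]]
  fix k l assume "k < dim_row ?S" "l < dim_col ?S"
  hence kl: "k < ?D" "l < ?D" by (auto simp: dims)
  have "total_ham d N H $$ (k, l) =
      (\<Sum>i<N. spectral ?D (tensor d N B) (\<lambda>k. h i (digit d i k)) $$ (k, l))"
  proof -
    have "local_op d N i (H i) = spectral ?D (tensor d N B) (\<lambda>k. h i (digit d i k))" if "i < N" for i
      unfolding H[OF that] by (rule local_op_spectral[OF d B that])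
    thus ?thesis using kl by (simp add: total_ham_def)
  qed
  also have "\<dots> = ?S $$ (k, l)"
    by (simp add: spectral_index[OF tensor_carrier kl] sum_distrib_right sum.swap[of _ "{..<N}"])
  finally show "total_ham d N H $$ (k, l) = ?S $$ (k, l)" .
qed (auto simp: total_ham_def carrier_matD[OF spectral_carrier[OF tensor_carrier]])

section \<open>Marginals as duals of local operators\<close>

lemma marginal_carrier [simp]: "marginal d N i \<rho> \<in> carrier_mat (d i) (d i)"
  by (simp add: marginal_def)

text \<open>Moves the restriction on index pairs into a conditional under a full double sum, where
  the order of summation can be changed.\<close>

lemma marginal_index:
  assumes "a < d i" "b < d i"
  shows "marginal d N i \<rho> $$ (a, b) = (\<Sum>k<tot_dim d N. \<Sum>l<tot_dim d N.
    if digit d i k = a \<and> digit d i l = b \<and> (\<forall>j<N. j \<noteq> i \<longrightarrow> digit d j k = digit d j l)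
    then \<rho> $$ (k, l) else 0)"
proof -
  let ?D = "{..<tot_dim d N}"
  let ?P = "\<lambda>k l. digit d i k = a \<and> digit d i l = b \<and> (\<forall>j<N. j \<noteq> i \<longrightarrow> digit d j k = digit d j l)"
  have set: "{(k, l). k < tot_dim d N \<and> l < tot_dim d N \<and> digit d i k = a \<and> digit d i l = b \<and>
      (\<forall>j<N. j \<noteq> i \<longrightarrow> digit d j k = digit d j l)} = {p \<in> ?D \<times> ?D. ?P (fst p) (snd p)}"
    by auto
  have "marginal d N i \<rho> $$ (a, b) = (\<Sum>(k, l) \<in> {p \<in> ?D \<times> ?D. ?P (fst p) (snd p)}. \<rho> $$ (k, l))"
    unfolding marginal_def index_mat(1)[OF assms] prod.case set ..
  also have "\<dots> = (\<Sum>p\<in>?D \<times> ?D. if ?P (fst p) (snd p) then \<rho> $$ p else 0)"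
    unfolding sum.inter_filter[OF finite_cartesian_product[OF finite_lessThan finite_lessThan]]
    by (intro sum.cong refl if_cong) (simp add: split_beta)
  also have "\<dots> = (\<Sum>k\<in>?D. \<Sum>l\<in>?D. if ?P k l then \<rho> $$ (k, l) else 0)"
    unfolding sum.cartesian_product by (intro sum.cong refl) (simp only: split_beta prod.collapse)
  finally show ?thesis .
qed

lemma marginal_adjoint:
  assumes "\<rho> \<in> carrier_mat (tot_dim d N) (tot_dim d N)" "mat_adjoint \<rho> = \<rho>"
  shows "mat_adjoint (marginal d N i \<rho>) = marginal d N i \<rho>"
proof (rule eq_matI)
  fix a b assume "a < dim_row (marginal d N i \<rho>)" "b < dim_col (marginal d N i \<rho>)"
  hence ab: "a < d i" "b < d i" by (auto simp: carrier_matD[OF marginal_carrier])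
  have sym: "cnj (\<rho> $$ (k, l)) = \<rho> $$ (l, k)" if "k < tot_dim d N" "l < tot_dim d N" for k l
    using that assms index_mat_adjoint[of l \<rho> k] by simp
  have "mat_adjoint (marginal d N i \<rho>) $$ (a, b) = cnj (marginal d N i \<rho> $$ (b, a))"
    using ab by (subst index_mat_adjoint) (auto simp: carrier_matD[OF marginal_carrier])
  also have "\<dots> = (\<Sum>k<tot_dim d N. \<Sum>l<tot_dim d N.
    if digit d i k = b \<and> digit d i l = a \<and> (\<forall>j<N. j \<noteq> i \<longrightarrow> digit d j k = digit d j l)
    then \<rho> $$ (l, k) else 0)"
    unfolding marginal_index[of _ d i, OF ab(2,1)] cnj_sum by (intro sum.cong refl) (auto simp: sym)
  also have "\<dots> = marginal d N i \<rho> $$ (a, b)"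
    unfolding marginal_index[of _ d i, OF ab]
    by (subst sum.swap) (intro sum.cong refl if_cong, auto)
  finally show "mat_adjoint (marginal d N i \<rho>) $$ (a, b) = marginal d N i \<rho> $$ (a, b)" .
qed (auto simp: carrier_matD[OF marginal_carrier])

lemma sum_swap_pairs:
  "(\<Sum>b\<in>B. \<Sum>a\<in>A. \<Sum>k\<in>K. \<Sum>l\<in>L. f b a k l) = (\<Sum>k\<in>K. \<Sum>l\<in>L. \<Sum>b\<in>B. \<Sum>a\<in>A. f b a k l)"
  for f :: "_ \<Rightarrow> _ \<Rightarrow> _ \<Rightarrow> _ \<Rightarrow> 'a :: comm_monoid_add"
proof -
  have "(\<Sum>b\<in>B. \<Sum>a\<in>A. \<Sum>k\<in>K. \<Sum>l\<in>L. f b a k l) = (\<Sum>b\<in>B. \<Sum>k\<in>K. \<Sum>l\<in>L. \<Sum>a\<in>A. f b a k l)"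
    by (rule sum.cong[OF refl], rule trans[OF sum.swap], rule sum.cong[OF refl], rule sum.swap)
  also have "\<dots> = (\<Sum>k\<in>K. \<Sum>l\<in>L. \<Sum>b\<in>B. \<Sum>a\<in>A. f b a k l)"
    by (rule trans[OF sum.swap], rule sum.cong[OF refl], rule sum.swap)
  finally show ?thesis .
qed

text \<open>Apart from the digits at \<open>i\<close>, an entry of \<open>local_op\<close> can be
  nonzero only where \<open>k\<close> and \<open>l\<close> agree, and these are the pairs that
  \<open>marginal\<close> sums over. The duality transports local energies to the marginals and is
  also the source of their positivity.\<close>

lemma trace_mult_marginal:
  assumes d: "\<And>i. i < N \<Longrightarrow> 1 \<le> d i" and i: "i < N" and A: "A \<in> carrier_mat (d i) (d i)"
    and \<rho>: "\<rho> \<in> carrier_mat (tot_dim d N) (tot_dim d N)"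
  shows "mat_trace (A * marginal d N i \<rho>) = mat_trace (local_op d N i A * \<rho>)"
proof -
  let ?D = "tot_dim d N"
  define E where "E k l \<longleftrightarrow> (\<forall>j<N. j \<noteq> i \<longrightarrow> digit d j k = digit d j l)" for k l
  have lo: "local_op d N i A $$ (l, k) = (if E k l then A $$ (digit d i l, digit d i k) else 0)"
    if "k < ?D" "l < ?D" for k l
  proof -
    have "local_op d N i A $$ (l, k) = (\<Prod>j<N. if j = i then A $$ (digit d i l, digit d i k)
        else if digit d j k = digit d j l then 1 else 0)"
      unfolding local_op_def tensor_index[OF that(2,1)]
      by (intro prod.cong refl) (use digit_less[of d] d in auto)
    also have "\<dots> = A $$ (digit d i l, digit d i k) *
        (\<Prod>j\<in>{..<N} - {i}. if digit d j k = digit d j l then 1 else 0)"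
      using i by (subst prod.remove[of _ i]) (auto intro!: prod.cong)
    also have "(\<Prod>j\<in>{..<N} - {i}. if digit d j k = digit d j l then 1 else 0 :: complex) =
        (if E k l then 1 else 0)"
    proof (cases "E k l")
      case False
      then obtain j where "j \<in> {..<N} - {i}" "digit d j k \<noteq> digit d j l" by (auto simp: E_def)
      thus ?thesis using False by (intro prod_zero[THEN trans]) auto
    qed (auto simp: E_def intro!: prod.neutral)
    finally show ?thesis by simp
  qed
  have "mat_trace (A * marginal d N i \<rho>) = (\<Sum>b<d i. \<Sum>a<d i. \<Sum>k<?D. \<Sum>l<?D.
      if digit d i k = a \<and> digit d i l = b \<and> E k l then A $$ (b, a) * \<rho> $$ (k, l) else 0)"
    unfolding mat_trace_mult[OF A marginal_carrier[of d N i \<rho>]]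
  proof (intro sum.cong refl)
    fix b a assume "b \<in> {..<d i}" "a \<in> {..<d i}"
    thus "A $$ (b, a) * marginal d N i \<rho> $$ (a, b) = (\<Sum>k<?D. \<Sum>l<?D.
        if digit d i k = a \<and> digit d i l = b \<and> E k l then A $$ (b, a) * \<rho> $$ (k, l) else 0)"
      by (auto simp: marginal_index sum_distrib_left E_def[symmetric] intro!: sum.cong)
  qed
  also have "\<dots> = (\<Sum>k<?D. \<Sum>l<?D. \<Sum>b<d i. \<Sum>a<d i.
      if digit d i k = a \<and> digit d i l = b \<and> E k l then A $$ (b, a) * \<rho> $$ (k, l) else 0)"
    by (rule sum_swap_pairs)
  also have "\<dots> = (\<Sum>k<?D. \<Sum>l<?D. local_op d N i A $$ (l, k) * \<rho> $$ (k, l))"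
  proof (intro sum.cong refl)
    fix k l assume kl: "k \<in> {..<?D}" "l \<in> {..<?D}"
    \<comment> \<open>For fixed \<open>k\<close> and \<open>l\<close> a single pair
      \<open>(b, a)\<close> contributes, namely their digits at \<open>i\<close>.\<close>
    have "(\<Sum>b<d i. \<Sum>a<d i. if digit d i k = a \<and> digit d i l = b \<and> E k l
          then A $$ (b, a) * \<rho> $$ (k, l) else 0) =
        (\<Sum>b<d i. if digit d i l = b then (\<Sum>a<d i. if digit d i k = a then
          (if E k l then A $$ (b, a) * \<rho> $$ (k, l) else 0) else 0) else 0)"
      by (intro sum.cong refl) (auto intro!: sum.cong)
    also have "\<dots> = (if E k l then A $$ (digit d i l, digit d i k) * \<rho> $$ (k, l) else 0)"
      using digit_less[of d i] d[OF i] by simp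
    finally show "(\<Sum>b<d i. \<Sum>a<d i. if digit d i k = a \<and> digit d i l = b \<and> E k l
          then A $$ (b, a) * \<rho> $$ (k, l) else 0) = local_op d N i A $$ (l, k) * \<rho> $$ (k, l)"
      using kl by (simp add: lo)
  qed
  also have "\<dots> = mat_trace (local_op d N i A * \<rho>)"
  proof -
    have "local_op d N i A \<in> carrier_mat ?D ?D" by (simp add: local_op_def)
    thus ?thesis by (subst mat_trace_mult[OF _ \<rho>]) (simp, rule sum.swap)
  qed
  finally show ?thesis .
qed

section \<open>Populations, entropy and thermal states\<close>

text \<open>The real part discards nothing where this is used: the diagonals of states and of local
  Hamiltonians in the bases concerned are real.\<close>

definition population :: "complex mat \<Rightarrow> complex mat \<Rightarrow> nat \<Rightarrow> real" where
  "population V \<rho> k = Re ((mat_adjoint V * \<rho> * V) $$ (k, k))"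

text \<open>Positivity and unit trace are expressed by a diagonalization with a probability vector,
  the form in which \<open>vn_entropy_spectral\<close> evaluates entropies.\<close>

definition density_mat :: "nat \<Rightarrow> complex mat \<Rightarrow> bool" where
  "density_mat n \<rho> \<longleftrightarrow> (\<exists>W x. unitary_mat n W \<and> (\<forall>k<n. 0 \<le> x k) \<and> (\<Sum>k<n. x k) = 1 \<and>
     \<rho> = spectral n W x)"

definition partition_fun :: "nat \<Rightarrow> real \<Rightarrow> (nat \<Rightarrow> real) \<Rightarrow> real" where
  "partition_fun n T h = (\<Sum>k<n. exp (- h k / T))"

definition gibbs :: "nat \<Rightarrow> real \<Rightarrow> (nat \<Rightarrow> real) \<Rightarrow> nat \<Rightarrow> real" where
  "gibbs n T h k = exp (- h k / T) / partition_fun n T h"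

lemma partition_fun_pos: "0 < n \<Longrightarrow> partition_fun n T h > 0"
  unfolding partition_fun_def by (intro sum_pos) auto

lemma gibbs_pos: "0 < n \<Longrightarrow> gibbs n T h k > 0"
  unfolding gibbs_def using partition_fun_pos by auto

lemma sum_gibbs: "0 < n \<Longrightarrow> (\<Sum>k<n. gibbs n T h k) = 1"
  using partition_fun_pos[of n T h]
  by (simp add: gibbs_def flip: sum_divide_distrib) (simp add: partition_fun_def)

text \<open>The affine dependence on the energy that turns the cross entropy with Gibbs weights into
  a function of the mean energy.\<close>

lemma log_gibbs:
  assumes "0 < n"
  shows "- log 2 (gibbs n T h k) = h k / (T * ln 2) + log 2 (partition_fun n T h)"
  using partition_fun_pos[OF assms, of T h]
  by (simp add: gibbs_def log_def ln_div field_simps)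

lemma thermal_spectral:
  assumes V: "unitary_mat n V"
  shows "thermal T (spectral n V h) = spectral n V (gibbs n T h)"
proof -
  note v = unitary_matD(1)[OF V]
  note dims = carrier_matD[OF spectral_carrier[OF v]]
  let ?E = "spectral n V (\<lambda>k. exp (- (1 / T) * h k))"
  have tr: "mat_trace ?E = of_real (partition_fun n T h)"
    unfolding trace_spectral[OF V] partition_fun_def by simp
  have "(1 / mat_trace ?E) \<cdot>\<^sub>m ?E = spectral n V (gibbs n T h)"
    unfolding tr
    by (rule eq_matI)
       (auto simp: dims spectral_index[OF v] gibbs_def sum_distrib_left intro!: sum.cong)
  thus ?thesis unfolding thermal_def Let_def herm_fun_spectral[OF V] .
qed

lemma real_diagonal_in_spectral:
  assumes V: "unitary_mat n V" and H: "real_diagonal_in n V H"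
  shows "H = spectral n V (population V H)"
proof -
  note v = unitary_matD[OF V]
  let ?X = "mat_adjoint V * H * V"
  have Hc: "H \<in> carrier_mat n n" using H by (simp add: real_diagonal_in_def)
  have X: "?X \<in> carrier_mat n n" using v Hc by auto
  have "?X $$ (k, l) = (if k = l then of_real (population V H l) else 0)" if "k < n" "l < n" for k l
    using H X that unfolding real_diagonal_in_def diagonal_mat_def population_def
    by (auto simp del: index_mult_mat(1))
  hence "?X = mat_diag n (\<lambda>k. of_real (population V H k))"
    using X by (intro eq_matI) (auto simp: mat_diag_def simp del: index_mult_mat(1))
  hence "V * mat_diag n (\<lambda>k. of_real (population V H k)) * mat_adjoint V = H"
    using spectral_conj[OF V X, of H] Hc by simp
  thus ?thesis by (simp add: spectral_def)
qed

section \<open>Overlaps of two bases and populations of states\<close>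

lemma unitary_mat_row_sum:
  assumes "unitary_mat n U" "k < n"
  shows "(\<Sum>j<n. (cmod (U $$ (k, j)))\<^sup>2) = 1"
proof -
  note u = unitary_matD[OF assms(1)]
  have "of_real (\<Sum>j<n. (cmod (U $$ (k, j)))\<^sup>2) = (\<Sum>j<n. U $$ (k, j) * mat_adjoint U $$ (j, k))"
    unfolding of_real_sum using u(1) assms(2)
    by (intro sum.cong refl) (auto simp: complex_norm_square[symmetric])
  also have "\<dots> = (U * mat_adjoint U) $$ (k, k)"
    by (rule index_mult_mat_sum[symmetric, OF u(1,2) assms(2) assms(2)])
  also have "\<dots> = of_real 1" using assms(2) by (simp add: u(4))
  finally show ?thesis by (simp only: of_real_eq_iff)
qed

lemma unitary_mat_col_sum:
  assumes "unitary_mat n U" "j < n"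
  shows "(\<Sum>k<n. (cmod (U $$ (k, j)))\<^sup>2) = 1"
proof -
  note u = unitary_matD[OF assms(1)]
  have "(\<Sum>k<n. (cmod (U $$ (k, j)))\<^sup>2) = (\<Sum>k<n. (cmod (mat_adjoint U $$ (j, k)))\<^sup>2)"
    using u(1) assms(2) by (intro sum.cong refl) auto
  thus ?thesis using unitary_mat_row_sum[OF unitary_mat_adjoint[OF assms(1)] assms(2)] by simp
qed

text \<open>Seen from the basis \<open>V\<close>, a diagonal entry averages the eigenvalues with the
  squared moduli of the overlaps between the two bases; in particular it is real.\<close>

lemma mat_adjoint_spectral_mult_index:
  assumes "V \<in> carrier_mat n n" "W \<in> carrier_mat n n" "k < n"
  shows "(mat_adjoint V * spectral n W x * V) $$ (k, k) =
    of_real (\<Sum>j<n. x j * (cmod ((mat_adjoint V * W) $$ (k, j)))\<^sup>2)"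
proof -
  have VW: "mat_adjoint V * W \<in> carrier_mat n n" using assms by auto
  have "mat_adjoint V * spectral n W x * V = spectral n (mat_adjoint V * W) x"
    using spectral_mult_left[of "mat_adjoint V" n W x] assms by simp
  thus ?thesis
    using VW assms(3)
    by (simp add: spectral_index complex_norm_square[symmetric] mult.assoc del: index_mult_mat(1))
qed

lemma population_spectral:
  assumes "V \<in> carrier_mat n n" "W \<in> carrier_mat n n" "k < n"
  shows "population V (spectral n W x) k = (\<Sum>j<n. x j * (cmod ((mat_adjoint V * W) $$ (k, j)))\<^sup>2)"
  unfolding population_def mat_adjoint_spectral_mult_index[OF assms] by simp

lemma population_spectral_same:
  assumes "unitary_mat n V" "k < n"
  shows "population V (spectral n V x) k = x k"
proof -
  note v = unitary_matD[OF assms(1)]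
  have "population V (spectral n V x) k = (\<Sum>j<n. if j = k then x j else 0)"
    unfolding population_spectral[OF v(1,1) assms(2)] v(3) using assms(2)
    by (intro sum.cong refl) auto
  thus ?thesis using assms(2) by simp
qed

lemma population_density:
  assumes V: "unitary_mat n V" and \<rho>: "density_mat n \<rho>"
  shows "k < n \<Longrightarrow> 0 \<le> population V \<rho> k" "(\<Sum>k<n. population V \<rho> k) = 1"
proof -
  obtain W x where W: "unitary_mat n W" "\<And>k. k < n \<Longrightarrow> 0 \<le> x k" "(\<Sum>k<n. x k) = 1"
    "\<rho> = spectral n W x" using \<rho> unfolding density_mat_def by blast
  note pop = population_spectral[OF unitary_matD(1)[OF V] unitary_matD(1)[OF W(1)], of _ x,
      folded W(4)]
  show "0 \<le> population V \<rho> k" if "k < n" for k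
    unfolding pop[OF that] using W(2) by (intro sum_nonneg mult_nonneg_nonneg) auto
  let ?u = "\<lambda>k j. (cmod ((mat_adjoint V * W) $$ (k, j)))\<^sup>2"
  have "(\<Sum>k<n. population V \<rho> k) = (\<Sum>k<n. \<Sum>j<n. x j * ?u k j)"
    using pop by (intro sum.cong) auto
  also have "\<dots> = (\<Sum>j<n. x j * (\<Sum>k<n. ?u k j))"
    unfolding sum_distrib_left by (rule sum.swap)
  also have "\<dots> = (\<Sum>j<n. x j)"
    using unitary_mat_col_sum[OF unitary_mat_mult[OF unitary_mat_adjoint[OF V] W(1)]]
    by (intro sum.cong) (auto simp del: index_mult_mat(1))
  finally show "(\<Sum>k<n. population V \<rho> k) = 1" using W(3) by simp
qed

lemma density_mat_carrier: "density_mat n \<rho> \<Longrightarrow> \<rho> \<in> carrier_mat n n"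
  unfolding density_mat_def using spectral_carrier unitary_matD(1) by blast

lemma density_mat_adjoint: "density_mat n \<rho> \<Longrightarrow> mat_adjoint \<rho> = \<rho>"
  unfolding density_mat_def using spectral_adjoint unitary_matD(1) by blast

lemma trace_spectral_density:
  assumes V: "unitary_mat n V" and \<rho>: "density_mat n \<rho>"
  shows "mat_trace (spectral n V x * \<rho>) = of_real (\<Sum>k<n. x k * population V \<rho> k)"
proof -
  obtain W y where W: "unitary_mat n W" "\<rho> = spectral n W y"
    using \<rho> unfolding density_mat_def by blast
  have "(mat_adjoint V * \<rho> * V) $$ (k, k) = of_real (population V \<rho> k)" if "k < n" for k
    unfolding W(2) population_def
      mat_adjoint_spectral_mult_index[OF unitary_matD(1)[OF V] unitary_matD(1)[OF W(1)] that] by simp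
  thus ?thesis
    using trace_spectral_mult[OF unitary_matD(1)[OF V] density_mat_carrier[OF \<rho>], of x]
    by (simp del: index_mult_mat(1))
qed

lemma diag_part_density:
  assumes V: "unitary_mat n V" and \<rho>: "density_mat n \<rho>"
  shows "diag_part V \<rho> = spectral n V (population V \<rho>)"
proof -
  obtain W y where W: "unitary_mat n W" "\<rho> = spectral n W y"
    using \<rho> unfolding density_mat_def by blast
  have "(mat_adjoint V * \<rho> * V) $$ (k, k) = of_real (population V \<rho> k)" if "k < n" for k
    unfolding W(2) population_def
      mat_adjoint_spectral_mult_index[OF unitary_matD(1)[OF V] unitary_matD(1)[OF W(1)] that] by simp
  hence "mat_diag n (\<lambda>k. (mat_adjoint V * \<rho> * V) $$ (k, k)) =
      mat_diag n (\<lambda>k. of_real (population V \<rho> k))"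
    unfolding mat_diag_def by (intro eq_matI) (auto simp del: index_mult_mat(1))
  thus ?thesis
    using density_mat_carrier[OF \<rho>] unfolding diag_part_def spectral_def by simp
qed

text \<open>If \<open>W\<close> diagonalizes the state, then \<open>U * W\<close> diagonalizes the
  evolved one with the same eigenvalues.\<close>

lemma density_mat_evolve:
  assumes U: "unitary_mat n U" and \<rho>: "density_mat n \<rho>"
  shows "density_mat n (evolve U \<rho>)" "vn_entropy (evolve U \<rho>) = vn_entropy \<rho>"
proof -
  obtain W x where W: "unitary_mat n W" "\<forall>k<n. 0 \<le> x k" "(\<Sum>k<n. x k) = 1"
    "\<rho> = spectral n W x" using \<rho> unfolding density_mat_def by blast
  have ev: "evolve U \<rho> = spectral n (U * W) x"
    unfolding evolve_def W(4)
    by (rule spectral_mult_left[symmetric, OF unitary_matD(1)[OF U] unitary_matD(1)[OF W(1)]])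
  show "density_mat n (evolve U \<rho>)"
    unfolding density_mat_def ev using W(2,3) unitary_mat_mult[OF U W(1)] by blast
  show "vn_entropy (evolve U \<rho>) = vn_entropy \<rho>"
    unfolding ev unfolding W(4) vn_entropy_spectral[OF W(1)]
      vn_entropy_spectral[OF unitary_mat_mult[OF U W(1)]] ..
qed

section \<open>Klein's inequality and the Gibbs bound on the entropy\<close>

lemma relative_entropy_term_bound:
  assumes "0 \<le> a" "0 < p"
  shows "(a - p) / ln 2 \<le> a * log 2 a - a * log 2 p"
proof (cases "a = 0")
  case True
  thus ?thesis using assms by (simp add: field_simps)
next
  case False
  hence a: "a > 0" using assms by simp
  \<comment> \<open>The tangent bound of the logarithm at 1; \<open>a = 0\<close> was split off
    because of this quotient.\<close>
  have "ln (p / a) \<le> p / a - 1" using a assms by (intro ln_le_minus_one) auto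
  hence "a * ln (p / a) \<le> a * (p / a - 1)" using a by (intro mult_left_mono) auto
  also have "\<dots> = p - a" using a by (simp add: field_simps)
  finally have "a - p \<le> a * ln a - a * ln p"
    using a assms by (simp add: ln_div algebra_simps)
  hence "(a - p) / ln 2 \<le> (a * ln a - a * ln p) / ln 2" by (intro divide_right_mono) auto
  thus ?thesis by (simp add: log_def diff_divide_distrib)
qed

text \<open>Klein's inequality: with the doubly stochastic weights \<open>u k j\<close> relating the eigenbasis of
  \<open>\<rho>\<close> to \<open>V\<close>, both sides become averages of terms indexed by \<open>(k, j)\<close>.\<close>

lemma vn_entropy_le_cross_entropy:
  assumes V: "unitary_mat n V" and \<rho>: "density_mat n \<rho>"
    and p: "\<And>k. k < n \<Longrightarrow> 0 < p k" "(\<Sum>k<n. p k) = 1"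
  shows "vn_entropy \<rho> \<le> - (\<Sum>k<n. population V \<rho> k * log 2 (p k))"
proof -
  obtain W x where W: "unitary_mat n W" "\<And>k. k < n \<Longrightarrow> 0 \<le> x k" "(\<Sum>k<n. x k) = 1"
    "\<rho> = spectral n W x" using \<rho> unfolding density_mat_def by blast
  define u where "u k j = (cmod ((mat_adjoint V * W) $$ (k, j)))\<^sup>2" for k j
  have VW: "unitary_mat n (mat_adjoint V * W)" by (intro unitary_mat_mult unitary_mat_adjoint V W)
  have row: "(\<Sum>j<n. u k j) = 1" if "k < n" for k
    unfolding u_def by (rule unitary_mat_row_sum[OF VW that])
  have col: "(\<Sum>k<n. u k j) = 1" if "j < n" for j
    unfolding u_def by (rule unitary_mat_col_sum[OF VW that])
  have pop: "population V \<rho> k = (\<Sum>j<n. x j * u k j)" if "k < n" for k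
    unfolding W(4) u_def
    by (rule population_spectral[OF unitary_matD(1)[OF V] unitary_matD(1)[OF W(1)] that])
  have split_col: "(\<Sum>k<n. \<Sum>j<n. u k j * f j) = (\<Sum>j<n. f j)" for f
  proof -
    have "(\<Sum>k<n. \<Sum>j<n. u k j * f j) = (\<Sum>j<n. (\<Sum>k<n. u k j) * f j)"
      unfolding sum_distrib_right by (rule sum.swap)
    thus ?thesis using col by simp
  qed
  have split_row: "(\<Sum>k<n. \<Sum>j<n. u k j * f k) = (\<Sum>k<n. f k)" for f
    using row by (simp flip: sum_distrib_right)
  \<comment> \<open>\<open>x\<close> and \<open>p\<close> have the same total, so the lower bounds
    of the single terms cancel in the sum and the relative entropy comes out nonnegative.\<close>
  have "0 = (\<Sum>k<n. \<Sum>j<n. u k j * ((x j - p k) / ln 2))"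
    using split_col[of "\<lambda>j. x j / ln 2"] split_row[of "\<lambda>k. p k / ln 2"] W(3) p(2)
    by (simp add: diff_divide_distrib right_diff_distrib sum_subtractf flip: sum_divide_distrib)
  also have "\<dots> \<le> (\<Sum>k<n. \<Sum>j<n. u k j * (x j * log 2 (x j) - x j * log 2 (p k)))"
    using W(2) p(1) by (intro sum_mono mult_left_mono relative_entropy_term_bound) (auto simp: u_def)
  also have "\<dots> = (\<Sum>j<n. x j * log 2 (x j)) - (\<Sum>k<n. population V \<rho> k * log 2 (p k))"
    using split_col[of "\<lambda>j. x j * log 2 (x j)"]
    by (simp add: pop right_diff_distrib sum_subtractf sum_distrib_left ac_simps)
  finally show ?thesis unfolding W(4) vn_entropy_spectral[OF W(1)] by simp
qed

lemma cross_entropy_gibbs: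
  assumes "0 < n" "(\<Sum>k<n. q k) = 1"
  shows "- (\<Sum>k<n. q k * log 2 (gibbs n T h k)) =
    (\<Sum>k<n. h k * q k) / (T * ln 2) + log 2 (partition_fun n T h)"
proof -
  have "- (\<Sum>k<n. q k * log 2 (gibbs n T h k)) =
      (\<Sum>k<n. q k * (h k / (T * ln 2) + log 2 (partition_fun n T h)))"
    unfolding log_gibbs[OF assms(1), symmetric] by (simp add: sum_negf)
  also have "\<dots> = (\<Sum>k<n. h k * q k) / (T * ln 2) + (\<Sum>k<n. q k) * log 2 (partition_fun n T h)"
    by (simp add: distrib_left sum.distrib sum_distrib_right sum_divide_distrib mult.commute)
  finally show ?thesis using assms by simp
qed

text \<open>Klein's inequality with Gibbs weights as \<open>p\<close>. The temperature is a free
  parameter here; \<open>vn_entropy_gibbs\<close> shows that the bound is attained by the Gibbs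
  state at that same temperature.\<close>

lemma vn_entropy_le_free_energy:
  assumes "0 < n" "unitary_mat n V" "density_mat n \<rho>"
  shows "vn_entropy \<rho> \<le>
    Re (mat_trace (spectral n V h * \<rho>)) / (T * ln 2) + log 2 (partition_fun n T h)"
  using vn_entropy_le_cross_entropy[OF assms(2,3), of "gibbs n T h"] assms(1)
    cross_entropy_gibbs[OF assms(1) population_density(2)[OF assms(2,3)], of T h]
  by (simp add: gibbs_pos sum_gibbs trace_spectral_density[OF assms(2,3)])

lemma density_mat_gibbs:
  assumes "0 < n" "unitary_mat n V"
  shows "density_mat n (spectral n V (gibbs n T h))"
  unfolding density_mat_def
  using assms gibbs_pos[OF assms(1), of T h] sum_gibbs[OF assms(1), of T h] less_imp_le by blast

lemma vn_entropy_gibbs: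
  assumes "0 < n" "unitary_mat n V"
  shows "vn_entropy (spectral n V (gibbs n T h)) =
    Re (mat_trace (spectral n V h * spectral n V (gibbs n T h))) / (T * ln 2) +
    log 2 (partition_fun n T h)"
  unfolding vn_entropy_spectral[OF assms(2)] cross_entropy_gibbs[OF assms(1) sum_gibbs[OF assms(1)]]
    spectral_mult[OF assms(2)] trace_spectral[OF assms(2)] by simp

section \<open>Additivity over the parties, and marginals of states\<close>

lemma partition_fun_digits:
  "partition_fun (tot_dim d N) T (\<lambda>k. \<Sum>i<N. h i (digit d i k)) = (\<Prod>i<N. partition_fun (d i) T (h i))"
proof -
  have "exp (- (\<Sum>i<N. h i (digit d i k)) / T) = (\<Prod>i<N. exp (- h i (digit d i k) / T))" for k
    by (simp add: exp_sum[symmetric] sum_divide_distrib sum_negf)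
  thus ?thesis
    unfolding partition_fun_def using sum_prod_digits[where f = "\<lambda>i a. exp (- h i a / T)"] by simp
qed

lemma gibbs_digits:
  "gibbs (tot_dim d N) T (\<lambda>k. \<Sum>i<N. h i (digit d i k)) k = (\<Prod>i<N. gibbs (d i) T (h i) (digit d i k))"
  unfolding gibbs_def partition_fun_digits prod_dividef
  by (simp add: exp_sum[symmetric] sum_divide_distrib sum_negf)

text \<open>Marginalization of a product distribution: \<open>g\<close> is absorbed into the factor
  at \<open>i\<close>, and all other factors sum to 1.\<close>

lemma sum_prod_digits_weight:
  fixes p :: "nat \<Rightarrow> nat \<Rightarrow> 'a :: comm_semiring_1"
  assumes "\<And>i. i < N \<Longrightarrow> (\<Sum>a<d i. p i a) = 1" "i < N"
  shows "(\<Sum>k<tot_dim d N. (\<Prod>j<N. p j (digit d j k)) * g (digit d i k)) = (\<Sum>a<d i. p i a * g a)"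
proof -
  let ?f = "\<lambda>j a. p j a * (if j = i then g a else 1)"
  have "(\<Prod>j<N. ?f j (digit d j k)) = (\<Prod>j<N. p j (digit d j k)) * g (digit d i k)" for k
  proof -
    have "(\<Prod>j<N. if j = i then g (digit d j k) else 1) = g (digit d i k)"
      using assms(2) by simp
    thus ?thesis by (simp only: prod.distrib)
  qed
  hence "(\<Sum>k<tot_dim d N. (\<Prod>j<N. p j (digit d j k)) * g (digit d i k)) =
      (\<Sum>k<tot_dim d N. \<Prod>j<N. ?f j (digit d j k))"
    by simp
  also have "\<dots> = (\<Prod>j<N. \<Sum>a<d j. ?f j a)"
    by (rule sum_prod_digits)
  also have "\<dots> = (\<Prod>j<N. if j = i then \<Sum>a<d j. p j a * g a else 1)"
    by (intro prod.cong refl) (auto simp: assms(1))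
  also have "\<dots> = (\<Sum>a<d i. p i a * g a)" using assms(2) by simp
  finally show ?thesis .
qed

text \<open>Positive weights let the logarithm of the product split into a sum, and each summand
  sees only its own factor of the product distribution.\<close>

lemma vn_entropy_tensor:
  assumes d: "\<And>i. i < N \<Longrightarrow> 1 \<le> d i" and B: "\<And>i. i < N \<Longrightarrow> unitary_mat (d i) (B i)"
    and p: "\<And>i a. i < N \<Longrightarrow> 0 < p i a" "\<And>i. i < N \<Longrightarrow> (\<Sum>a<d i. p i a) = 1"
  shows "vn_entropy (tensor d N (\<lambda>i. spectral (d i) (B i) (p i))) =
    (\<Sum>i<N. vn_entropy (spectral (d i) (B i) (p i)))"
proof -
  let ?P = "\<lambda>k. \<Prod>i<N. p i (digit d i k)"
  have ts: "tensor d N (\<lambda>i. spectral (d i) (B i) (p i)) =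
      spectral (tot_dim d N) (tensor d N B) ?P"
    by (rule tensor_spectral[OF d unitary_matD(1)[OF B]])
  have "vn_entropy (tensor d N (\<lambda>i. spectral (d i) (B i) (p i))) =
      - (\<Sum>k<tot_dim d N. ?P k * log 2 (?P k))"
    unfolding ts by (rule vn_entropy_spectral[OF unitary_tensor[OF d B]])
  also have "(\<Sum>k<tot_dim d N. ?P k * log 2 (?P k)) =
      (\<Sum>k<tot_dim d N. \<Sum>i<N. ?P k * log 2 (p i (digit d i k)))"
  proof (intro sum.cong refl)
    fix k
    have "ln (?P k) = (\<Sum>i<N. ln (p i (digit d i k)))"
      by (rule ln_prod[OF finite_lessThan]) (metis p(1) less_irrefl lessThan_iff)
    thus "?P k * log 2 (?P k) = (\<Sum>i<N. ?P k * log 2 (p i (digit d i k)))"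
      by (simp add: log_def sum_divide_distrib sum_distrib_left)
  qed
  also have "\<dots> = (\<Sum>i<N. \<Sum>k<tot_dim d N. ?P k * log 2 (p i (digit d i k)))"
    by (rule sum.swap)
  also have "\<dots> = (\<Sum>i<N. \<Sum>a<d i. p i a * log 2 (p i a))"
    by (intro sum.cong refl sum_prod_digits_weight[where g = "\<lambda>a. log 2 (p _ a)"] p(2)) auto
  also have "- \<dots> = (\<Sum>i<N. vn_entropy (spectral (d i) (B i) (p i)))"
    by (simp add: vn_entropy_spectral[OF B] sum_negf cong: sum.cong_simp)
  finally show ?thesis .
qed

lemma trace_total_ham_mult:
  assumes \<rho>: "\<rho> \<in> carrier_mat (tot_dim d N) (tot_dim d N)"
  shows "mat_trace (total_ham d N H * \<rho>) = (\<Sum>i<N. mat_trace (local_op d N i (H i) * \<rho>))"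
proof -
  let ?D = "tot_dim d N"
  have lo: "local_op d N i (H i) \<in> carrier_mat ?D ?D" for i by (simp add: local_op_def)
  have th: "total_ham d N H \<in> carrier_mat ?D ?D" by (simp add: total_ham_def)
  have "mat_trace (total_ham d N H * \<rho>) =
      (\<Sum>k<?D. \<Sum>l<?D. \<Sum>i<N. local_op d N i (H i) $$ (k, l) * \<rho> $$ (l, k))"
    unfolding mat_trace_mult[OF th \<rho>] by (simp add: total_ham_def sum_distrib_right)
  also have "\<dots> = (\<Sum>k<?D. \<Sum>i<N. \<Sum>l<?D. local_op d N i (H i) $$ (k, l) * \<rho> $$ (l, k))"
    by (rule sum.cong[OF refl], rule sum.swap)
  also have "\<dots> = (\<Sum>i<N. \<Sum>k<?D. \<Sum>l<?D. local_op d N i (H i) $$ (k, l) * \<rho> $$ (l, k))"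
    by (rule sum.swap)
  finally show ?thesis unfolding mat_trace_mult[OF lo \<rho>] .
qed

text \<open>An eigenbasis \<open>Y\<close> of the marginal is extended by standard bases of the
  other factors to a product basis of the whole space. The eigenvalues of the marginal are then sums
  of populations of \<open>\<rho>\<close> in that basis.\<close>

lemma density_mat_marginal:
  assumes d: "\<And>i. i < N \<Longrightarrow> 1 \<le> d i" and i: "i < N" and \<rho>: "density_mat (tot_dim d N) \<rho>"
  shows "density_mat (d i) (marginal d N i \<rho>)"
proof -
  let ?D = "tot_dim d N" and ?\<sigma> = "marginal d N i \<rho>"
  have \<rho>c: "\<rho> \<in> carrier_mat ?D ?D" by (rule density_mat_carrier[OF \<rho>])
  obtain Y x where Y: "unitary_mat (d i) Y" and \<sigma>: "?\<sigma> = spectral (d i) Y x"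
    using spectral_theorem[OF marginal_carrier marginal_adjoint[OF \<rho>c density_mat_adjoint[OF \<rho>]]]
    by blast
  define X where "X j = (if j = i then Y else 1\<^sub>m (d j))" for j
  have X: "unitary_mat (d j) (X j)" if "j < N" for j
    using Y by (auto simp: X_def unitary_mat_def)
  have TX: "unitary_mat ?D (tensor d N X)" by (rule unitary_tensor[OF d X])
  note pop = population_density[OF TX \<rho>]
  \<comment> \<open>The duality is tested on observables diagonal in \<open>Y\<close>. Indicator
    functions \<open>f\<close> will isolate single eigenvalues, and the constant 1 gives their
    sum.\<close>
  have key: "(\<Sum>a<d i. f a * x a) = (\<Sum>k<?D. f (digit d i k) * population (tensor d N X) \<rho> k)" for f
  proof -
    have "complex_of_real (\<Sum>a<d i. f a * x a) = mat_trace (spectral (d i) (X i) f * ?\<sigma>)"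
      unfolding \<sigma> by (simp add: X_def spectral_mult[OF Y] trace_spectral[OF Y])
    also have "\<dots> = mat_trace (local_op d N i (spectral (d i) (X i) f) * \<rho>)"
      by (rule trace_mult_marginal[OF d i spectral_carrier[OF unitary_matD(1)[OF X[OF i]]] \<rho>c])
    also have "\<dots> = of_real (\<Sum>k<?D. f (digit d i k) * population (tensor d N X) \<rho> k)"
    proof -
      have lo: "local_op d N i (spectral (d i) (X i) f) =
          spectral ?D (tensor d N X) (\<lambda>k. f (digit d i k))"
        by (rule local_op_spectral[OF d X i])
      show ?thesis unfolding lo by (rule trace_spectral_density[OF TX \<rho>])
    qed
    finally show ?thesis by (simp only: of_real_eq_iff)
  qed
  have "0 \<le> x a" if a: "a < d i" for a
  proof -
    have "x a = (\<Sum>b<d i. (if b = a then 1 else 0) * x b)"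
      using a by (simp add: if_distrib[of "\<lambda>y. y * _"] cong: if_cong)
    also have "\<dots> \<ge> 0" unfolding key using pop(1) by (intro sum_nonneg) auto
    finally show ?thesis .
  qed
  moreover have "(\<Sum>a<d i. x a) = 1" using key[of "\<lambda>_. 1"] pop(2) by simp
  ultimately show ?thesis unfolding density_mat_def using Y \<sigma> by blast
qed

section \<open>Coherence and total correlation of the evolved state\<close>

theorem mainTheorem3:
  fixes N :: nat and d :: "nat \<Rightarrow> nat"
    and B H :: "nat \<Rightarrow> complex mat"
    and T T' \<Delta>E M :: real
    and V Htot \<rho>T \<rho>T' U \<rho>f :: "complex mat"
  assumes "N \<ge> 1"
    and "\<And>i. i < N \<Longrightarrow> d i \<ge> 1"
    and "\<And>i. i < N \<Longrightarrow> unitary_mat (d i) (B i)"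
    and "\<And>i. i < N \<Longrightarrow> real_diagonal_in (d i) (B i) (H i)"
    and "0 < T" and "T < T'"
    and "V = tensor d N B"
    and "Htot = total_ham d N H"
    and "\<rho>T = tensor d N (\<lambda>i. thermal T (H i))"
    and "\<rho>T' = tensor d N (\<lambda>i. thermal T' (H i))"
    and "\<Delta>E = energy_diff Htot \<rho>T' \<rho>T"
    and "M = (\<Sum>i<N. vn_entropy (thermal T' (H i)) - vn_entropy (thermal T (H i)))"
    and "unitary_mat (tot_dim d N) U"
    and "\<rho>f = evolve U \<rho>T"
    and "energy_diff Htot \<rho>f \<rho>T = \<Delta>E"
  shows
    "(total_corr d N \<rho>f = max_total_corr d N Htot \<rho>T \<Delta>E \<and> max_total_corr d N Htot \<rho>T \<Delta>E = M
        \<longrightarrow> rel_ent_coherence V \<rho>f \<le> max_total_corr d N Htot \<rho>T \<Delta>E) \<and>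
     (rel_ent_coherence V \<rho>f = max_coherence V Htot \<rho>T \<Delta>E \<and> max_coherence V Htot \<rho>T \<Delta>E = M
        \<longrightarrow> total_corr d N \<rho>f \<le> max_coherence V Htot \<rho>T \<Delta>E)"
proof -
  note d = assms(2) and B = assms(3)
  let ?D = "tot_dim d N"
  define h where "h i = population (B i) (H i)" for i
  define E where "E k = (\<Sum>i<N. h i (digit d i k))" for k
  \<comment> \<open>The energy term of the Gibbs bound at T'. It is written with
    \<open>\<rho>f\<close>, but \<open>energy\<close> below makes it that of \<open>\<rho>T'\<close>
    as well.\<close>
  define F where "F = Re (mat_trace (Htot * \<rho>f)) / (T' * ln 2)"
  have H: "H i = spectral (d i) (B i) (h i)" if "i < N" for i
    unfolding h_def by (rule real_diagonal_in_spectral[OF B[OF that] assms(4)[OF that]])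
  have V: "unitary_mat ?D V" unfolding assms(7) by (rule unitary_tensor[OF d B])
  have D: "0 < ?D" by (rule tot_dim_pos[OF d])
  have dpos: "0 < d i" if "i < N" for i using d[OF that] by simp
  have Htot: "Htot = spectral ?D V E"
    unfolding assms(7,8) E_def by (rule total_ham_spectral[OF d B H])
  have local_thermal: "thermal t (H i) = spectral (d i) (B i) (gibbs (d i) t (h i))"
    if "i < N" for t i
    unfolding H[OF that] by (rule thermal_spectral[OF B[OF that]])
  have tensor_thermal: "tensor d N (\<lambda>i. thermal t (H i)) =
      tensor d N (\<lambda>i. spectral (d i) (B i) (gibbs (d i) t (h i)))" for t
    using local_thermal by (rule tensor_cong)
  \<comment> \<open>Without interaction the product of the local Gibbs states is the Gibbs state of
    \<open>Htot\<close>, so the equality case of the bound applies to the whole system.\<close>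
  have total_thermal: "tensor d N (\<lambda>i. thermal t (H i)) = spectral ?D V (gibbs ?D t E)" for t
    unfolding tensor_thermal E_def gibbs_digits[abs_def] assms(7)
    by (rule tensor_spectral[OF d unitary_matD(1)[OF B]])
  have entropy_sum: "vn_entropy (tensor d N (\<lambda>i. thermal t (H i))) =
      (\<Sum>i<N. vn_entropy (thermal t (H i)))" for t
  proof -
    have "vn_entropy (tensor d N (\<lambda>i. spectral (d i) (B i) (gibbs (d i) t (h i)))) =
        (\<Sum>i<N. vn_entropy (spectral (d i) (B i) (gibbs (d i) t (h i))))"
      by (rule vn_entropy_tensor[OF d B gibbs_pos[OF dpos] sum_gibbs[OF dpos]])
    thus ?thesis unfolding tensor_thermal by (simp add: local_thermal)
  qed
  have dens: "density_mat ?D \<rho>T" "density_mat ?D \<rho>T'"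
    unfolding assms(9,10) total_thermal by (rule density_mat_gibbs[OF D V])+
  have densf: "density_mat ?D \<rho>f" and Sf: "vn_entropy \<rho>f = vn_entropy \<rho>T"
    unfolding assms(14) by (rule density_mat_evolve[OF assms(13) dens(1)])+
  note car = density_mat_carrier[OF dens(1)] density_mat_carrier[OF dens(2)]
    density_mat_carrier[OF densf]
  have HtotC: "Htot \<in> carrier_mat ?D ?D" 
    unfolding Htot by (rule spectral_carrier[OF unitary_matD(1)[OF V]])
  \<comment> \<open>Both costs are measured from the same \<open>\<rho>T\<close>, so equal costs
    mean equal energies.\<close>
  have energy: "Re (mat_trace (Htot * \<rho>f)) = Re (mat_trace (Htot * \<rho>T'))"
  proof -
    have "energy_diff Htot \<sigma> \<rho>T = Re (mat_trace (Htot * \<sigma>)) - Re (mat_trace (Htot * \<rho>T))"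
      if "\<sigma> \<in> carrier_mat ?D ?D" for \<sigma>
    proof -
      have dif: "\<sigma> - \<rho>T \<in> carrier_mat ?D ?D" using car by (intro minus_carrier_mat) auto
      show ?thesis
        unfolding energy_diff_def mat_trace_mult[OF HtotC that] mat_trace_mult[OF HtotC car(1)]
          mat_trace_mult[OF HtotC dif]
        using that car(1) by (simp add: right_diff_distrib sum_subtractf)
    qed
    from this[OF car(2)] this[OF car(3)] show ?thesis using assms(11,15) by simp
  qed
  have thermal_entropy: "(\<Sum>i<N. vn_entropy (thermal T' (H i))) = F + log 2 (partition_fun ?D T' E)"
    unfolding entropy_sum[symmetric] total_thermal vn_entropy_gibbs[OF D V] F_def energy
    unfolding assms(10) total_thermal Htot ..
  have M: "M = F + log 2 (partition_fun ?D T' E) - vn_entropy \<rho>f"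
    unfolding assms(12) sum_subtractf thermal_entropy Sf assms(9) entropy_sum ..
  have "rel_ent_coherence V \<rho>f \<le> M"
  proof -
    let ?\<rho>D = "diag_part V \<rho>f"
    have \<rho>D: "?\<rho>D = spectral ?D V (population V \<rho>f)" by (rule diag_part_density[OF V densf])
    have densD: "density_mat ?D ?\<rho>D"
      unfolding density_mat_def using \<rho>D V population_density[OF V densf] by blast
    \<comment> \<open>\<open>Htot\<close> is diagonal in the reference basis \<open>V\<close>, and
      dephasing in \<open>V\<close> leaves the populations unchanged.\<close>
    have "mat_trace (Htot * ?\<rho>D) = mat_trace (Htot * \<rho>f)"
      unfolding Htot trace_spectral_density[OF V densD] trace_spectral_density[OF V densf]
      unfolding \<rho>D by (simp add: population_spectral_same[OF V])
    hence "vn_entropy ?\<rho>D \<le> F + log 2 (partition_fun ?D T' E)"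
      using vn_entropy_le_free_energy[OF D V densD, of E T'] unfolding Htot F_def by simp
    thus ?thesis unfolding rel_ent_coherence_def M by simp
  qed
  moreover have "total_corr d N \<rho>f \<le> M"
  proof -
    have "vn_entropy (marginal d N i \<rho>f) \<le>
        Re (mat_trace (local_op d N i (H i) * \<rho>f)) / (T' * ln 2) + log 2 (partition_fun (d i) T' (h i))"
      if i: "i < N" for i
    proof -
      have HC: "H i \<in> carrier_mat (d i) (d i)"
        unfolding H[OF i] by (rule spectral_carrier[OF unitary_matD(1)[OF B[OF i]]])
      have "mat_trace (H i * marginal d N i \<rho>f) = mat_trace (local_op d N i (H i) * \<rho>f)"
        by (rule trace_mult_marginal[OF d i HC car(3)])
      thus ?thesis
        using vn_entropy_le_free_energy[OF dpos[OF i] B[OF i] density_mat_marginal[OF d i densf], of "h i" T']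
        unfolding H[OF i, symmetric] by simp
    qed
    hence "(\<Sum>i<N. vn_entropy (marginal d N i \<rho>f)) \<le>
        (\<Sum>i<N. Re (mat_trace (local_op d N i (H i) * \<rho>f)) / (T' * ln 2) +
          log 2 (partition_fun (d i) T' (h i)))"
      by (intro sum_mono) auto
    also have "\<dots> = F + (\<Sum>i<N. log 2 (partition_fun (d i) T' (h i)))"
      unfolding F_def assms(8) trace_total_ham_mult[OF car(3)]
      by (simp add: sum.distrib sum_divide_distrib)
    also have "(\<Sum>i<N. log 2 (partition_fun (d i) T' (h i))) = log 2 (partition_fun ?D T' E)"
    proof -
      have "ln (\<Prod>i<N. partition_fun (d i) T' (h i)) = (\<Sum>i<N. ln (partition_fun (d i) T' (h i)))"
        by (rule ln_prod[OF finite_lessThan]) (metis partition_fun_pos dpos less_irrefl lessThan_iff)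
      thus ?thesis unfolding E_def partition_fun_digits by (simp add: log_def sum_divide_distrib)
    qed
    finally show ?thesis unfolding total_corr_def M by simp
  qed
  \<comment> \<open>In each case the premise equates the maximum with \<open>M\<close>, the bound
    just established.\<close>
  ultimately show ?thesis by simp
qed

end
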